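(* Suppose that $Y$ is a complete metric space with $\dim_{\rm N} Y \le n < \infty$, and $Y$ is Lipschitz $m$-connected for $m = 0,1,\dots,n$. Then $Y$ is an absolute Lipschitz retract; equivalently, the pair $(X,Y)$ has the Lipschitz extension property for every metric space $X$.
   Context: A family $(B_i)_{i\in I}$ of subsets of a metric space $X=(X,d)$ is called $D$-bounded ($D \ge 0$) if $\operatorname{diam} B_i := \sup\{d(x,x') : x,x'\in B_i\} \le D$ for all $i$. For $s>0$, the $s$-multiplicity of the family is the infimum of all integers $n \ge 0$ such that every subset of $X$ with diameter $\le s$ meets at most $n$ members of the family. The Nagata dimension $\dim_{\rm N} X$ of a metric space $X$ is the infimum of all integers $n$ with the following property: there exists a constant $c>0$ such that for all $s>0$, $X$ has a $cs$-bounded covering with $s$-multiplicity at most $n+1$ (the value is $\infty$ if there is no such $n$). $\operatorname{Lip}(f)$ denotes the (smallest) Lipschitz constant of a Lipschitz map $f$. A metric space $Y$ is an absolute Lipschitz retract if, whenever $Y$ sits isometrically in a metric space $X$, there is a Lipschitz retraction from $X$ onto $Y$. A pair of metric spaces $(X,Y)$ has the Lipschitz extension property if there is a constant $C$ such that for every subset $Z \subset X$ and for every Lipschitz map $f \colon Z \to Y$, there is a Lipschitz extension $\bar f \colon X \to Y$ of $f$ with $\operatorname{Lip}(\bar f) \le C \operatorname{Lip}(f)$. A metric space $Y$ is called Lipschitz $m$-connected, for an integer $m \ge 0$, if there is a constant $c_m$ such that every Lipschitz map $f \colon S^m \to Y$ has a Lipschitz extension $\bar f \colon B^{m+1} \to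 Y$ with $\operatorname{Lip}(\bar f) \le c_m \operatorname{Lip}(f)$; here $S^m$ and $B^{m+1}$ denote the unit sphere and closed unit ball in $\mathbb{R}^{m+1}$ equipped with the metric induced from $\mathbb{R}^{m+1}$. *)

theory Defs
  imports "HOL-Analysis.Analysis"
begin

text \<open>The diameter takes values in the extended nonnegative reals, so it is \<open>\<infinity>\<close> for
  unbounded sets and 0 for the empty set.\<close>

definition mdiam :: "'a metric \<Rightarrow> 'a set \<Rightarrow> ennreal" where
  "mdiam X A = (SUP (x, y) \<in> A \<times> A. ennreal (mdist X x y))"

definition bounded_family :: "'a metric \<Rightarrow> real \<Rightarrow> 'i set \<Rightarrow> ('i \<Rightarrow> 'a set) \<Rightarrow> bool" where
  "bounded_family X D I B \<longleftrightarrow> (\<forall>i\<in>I. B i \<subseteq> mspace X \<and> mdiam X (B i) \<le> ennreal D)"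

definition multiplicity_at_scale :: "'a metric \<Rightarrow> real \<Rightarrow> 'i set \<Rightarrow> ('i \<Rightarrow> 'a set) \<Rightarrow> enat" where
  "multiplicity_at_scale X s I B =
     Inf {enat n |n. \<forall>A\<subseteq>mspace X. mdiam X A \<le> ennreal s \<longrightarrow>
                       finite {i\<in>I. A \<inter> B i \<noteq> {}} \<and> card {i\<in>I. A \<inter> B i \<noteq> {}} \<le> n}"

text \<open>The index sets of the coverings are drawn from the type \<^typ>\<open>'a set\<close>. This is no
  restriction: an arbitrary indexed covering can be replaced by the set of its members, indexed
  by themselves, without increasing diameters or multiplicity.\<close>

definition nagata_property :: "'a metric \<Rightarrow> int \<Rightarrow> bool" where
  "nagata_property X n \<longleftrightarrow>
     (\<exists>c>0. \<forall>s>0. \<exists>(I :: 'a set set) B.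
        (\<Union>i\<in>I. B i) = mspace X \<and>
        bounded_family X (c * s) I B \<and>
        ereal_of_enat (multiplicity_at_scale X s I B) \<le> ereal (of_int (n + 1)))"

definition nagata_dim :: "'a metric \<Rightarrow> ereal" where
  "nagata_dim X = Inf {ereal (of_int n) |n. nagata_property X n}"

text \<open>The smallest Lipschitz constant; only meaningful for Lipschitz maps, for which the infimum
  is attained.\<close>

definition Lip :: "'a metric \<Rightarrow> 'b metric \<Rightarrow> ('a \<Rightarrow> 'b) \<Rightarrow> real" where
  "Lip X Y f =
     Inf {L. 0 \<le> L \<and> (\<forall>x\<in>mspace X. \<forall>y\<in>mspace X. mdist Y (f x) (f y) \<le> L * mdist X x y)}"

definition Lipschitz_retraction :: "'a metric \<Rightarrow> 'a set \<Rightarrow> ('a \<Rightarrow> 'a) \<Rightarrow> bool" where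
  "Lipschitz_retraction X A r \<longleftrightarrow>
     A \<subseteq> mspace X \<and> Lipschitz_continuous_map X (submetric X A) r \<and> (\<forall>a\<in>A. r a = a)"

definition isometric_embedding :: "'a metric \<Rightarrow> 'b metric \<Rightarrow> ('a \<Rightarrow> 'b) \<Rightarrow> bool" where
  "isometric_embedding Y X e \<longleftrightarrow>
     e \<in> mspace Y \<rightarrow> mspace X \<and>
     (\<forall>y\<in>mspace Y. \<forall>y'\<in>mspace Y. mdist X (e y) (e y') = mdist Y y y')"

text \<open>HOL cannot quantify over all types inside a definition, so the type of the points of the
  ambient spaces is a parameter; leaving it as a free type variable in a theorem amounts to
  quantifying over all ambient metric spaces.\<close>

definition absolute_Lipschitz_retract :: "'x itself \<Rightarrow> 'y metric \<Rightarrow> bool" where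
  "absolute_Lipschitz_retract (_ :: 'x itself) Y \<longleftrightarrow>
     (\<forall>(X :: 'x metric) e. isometric_embedding Y X e \<longrightarrow>
        (\<exists>r. Lipschitz_retraction X (e ` mspace Y) r))"

definition Lipschitz_extension_property :: "'x metric \<Rightarrow> 'y metric \<Rightarrow> bool" where
  "Lipschitz_extension_property X Y \<longleftrightarrow>
     (\<exists>C::real. \<forall>Z\<subseteq>mspace X. \<forall>f. Lipschitz_continuous_map (submetric X Z) Y f \<longrightarrow>
        (\<exists>g. Lipschitz_continuous_map X Y g \<and> (\<forall>z\<in>Z. g z = f z) \<and>
             Lip X Y g \<le> C * Lip (submetric X Z) Y f))"

text \<open>Euclidean space of variable dimension \<open>N\<close>, on the carrier of \<^term>\<open>Euclidean_space N\<close>: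
  real sequences vanishing from index \<open>N\<close> on.\<close>

definition Euclidean_metric_space :: "nat \<Rightarrow> (nat \<Rightarrow> real) metric" where
  "Euclidean_metric_space N =
     metric ({x. \<forall>i\<ge>N. x i = 0}, \<lambda>x y. L2_set (\<lambda>i. x i - y i) {..<N})"

lemma Metric_space_Euclidean:
  fixes N :: nat
  shows "Metric_space {x. \<forall>i\<ge>N. x i = 0} (\<lambda>x y. L2_set (\<lambda>i. x i - y i :: real) {..<N})"
proof
  fix x y z :: "nat \<Rightarrow> real"
  show "0 \<le> L2_set (\<lambda>i. x i - y i) {..<N}" by simp
  show "L2_set (\<lambda>i. x i - y i) {..<N} = L2_set (\<lambda>i. y i - x i) {..<N}"
    by (simp add: L2_set_def power2_commute)
  show "L2_set (\<lambda>i. x i - z i) {..<N} \<le>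
        L2_set (\<lambda>i. x i - y i) {..<N} + L2_set (\<lambda>i. y i - z i) {..<N}"
    using L2_set_triangle_ineq[of "\<lambda>i. x i - y i" "\<lambda>i. y i - z i" "{..<N}"] by simp
  assume "x \<in> {x. \<forall>i\<ge>N. x i = 0}" "y \<in> {x. \<forall>i\<ge>N. x i = 0}"
  then show "L2_set (\<lambda>i. x i - y i) {..<N} = 0 \<longleftrightarrow> x = y"
    by (auto simp: L2_set_eq_0_iff fun_eq_iff) (metis lessThan_iff not_le)
qed

lemma mspace_Euclidean_metric_space [simp]:
  "mspace (Euclidean_metric_space N) = {x. \<forall>i\<ge>N. x i = 0}"
  unfolding Euclidean_metric_space_def
  by (rule Metric_space.mspace_metric[OF Metric_space_Euclidean])

lemma mdist_Euclidean_metric_space [simp]: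
  "mdist (Euclidean_metric_space N) = (\<lambda>x y. L2_set (\<lambda>i. x i - y i) {..<N})"
  unfolding Euclidean_metric_space_def
  by (rule Metric_space.mdist_metric[OF Metric_space_Euclidean])

text \<open>The sphere \<open>S\<^sup>m\<close> and the closed ball \<open>B\<^sup>m\<^sup>+\<^sup>1\<close> both sit in dimension \<open>m + 1\<close>; the ball
  below is parameterised by the dimension of the ambient space.\<close>

definition unit_sphere :: "nat \<Rightarrow> (nat \<Rightarrow> real) metric" where
  "unit_sphere m = submetric (Euclidean_metric_space (m + 1))
     {x. mdist (Euclidean_metric_space (m + 1)) (\<lambda>_. 0) x = 1}"

definition unit_ball :: "nat \<Rightarrow> (nat \<Rightarrow> real) metric" where
  "unit_ball N = submetric (Euclidean_metric_space N)
     {x. mdist (Euclidean_metric_space N) (\<lambda>_. 0) x \<le> 1}"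

definition Lipschitz_connected :: "nat \<Rightarrow> 'y metric \<Rightarrow> bool" where
  "Lipschitz_connected m Y \<longleftrightarrow>
     (\<exists>c::real. \<forall>f. Lipschitz_continuous_map (unit_sphere m) Y f \<longrightarrow>
        (\<exists>g. Lipschitz_continuous_map (unit_ball (m + 1)) Y g \<and>
             (\<forall>x\<in>mspace (unit_sphere m). g x = f x) \<and>
             Lip (unit_ball (m + 1)) Y g \<le> c * Lip (unit_sphere m) Y f))"

end

theory Submission
  imports Defs
begin

text \<open>Let \<open>f\<close> be an \<open>L\<close>-Lipschitz map from \<open>Z \<subseteq> X\<close> to \<open>Y\<close>. Every point \<open>x\<close> of \<open>X\<close> determines the function
  \<open>h y = inf {d (f z, y) + L d (x, z) | z \<in> Z}\<close> on \<open>Y\<close>, which has the properties of the distances from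
  an additional point to the points of \<open>Y\<close> (\<open>katetov_envelope\<close>). It depends on \<open>x\<close> in an \<open>L\<close>-Lipschitz
  way for the supremum distance, and it vanishes at \<open>f x\<close> if \<open>x \<in> Z\<close>. Such functions are the Katetov
  functions of \<open>Y\<close>. So all extension problems are solved at once by a single Lipschitz map \<open>\<phi>\<close> from the
  Katetov functions to \<open>Y\<close> that sends a function vanishing at \<open>y\<close> to \<open>y\<close>
  (\<open>Lipschitz_map_from_katetov\<close>). A retraction onto an isometric copy of \<open>Y\<close> is an extension of the
  inverse of the embedding.

  The height of a Katetov function is its distance to \<open>Y\<close>. The functions of height 0 are dealt with by
  completeness. For the others a decomposition in the manner of Whitney is used: at height about
  \<open>r\<^sup>k\<close>, the map \<open>\<phi>\<close> may be built from a cover of \<open>Y\<close> by sets of size about \<open>r\<^sup>k\<close>, and errors of that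
  size are allowed. By the assumption on the Nagata dimension the nerve \<open>D\<^sub>k\<close> of such a cover has dimension
  at most \<open>n\<close>, bump functions send \<open>h\<close> to a point of the nerve, and a map \<open>g\<^sub>k\<close> from the nerve to \<open>Y\<close> is
  constructed over the skeleta by Lipschitz connectedness.

  The consecutive maps have to be joined. If the covers of two scales were combined, the nerve could get
  dimension \<open>2 n + 1\<close>, more than the connectedness of \<open>Y\<close> can fill. Instead, a simplicial map \<open>p\<close> from \<open>D\<^sub>k\<close> to
  the coarser nerve is chosen, and \<open>g\<^sub>k\<close> is deformed into \<open>g\<^sub>k\<^sub>+\<^sub>1 \<circ> p\<close>: this homotopy lives on a prism of
  dimension \<open>n + 1\<close>, whose cells are bounded by spheres of dimension at most \<open>n\<close>. The image of a point under
  \<open>p\<close> and the point given by the coarser cover lie in a common simplex, along which the remaining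
  correction is made (\<open>transition_exists\<close>, \<open>telescope_maps\<close>).

  All complexes are cubical: a point is a family of numbers in \<open>[0,1]\<close>, a cell is given by fixing some
  coordinates at 0 or 1, and distances are measured in the supremum norm. A nerve consists of
  the families that are supported in a simplex and have some coordinate equal to 1. This makes
  products with an interval and Lipschitz estimates simple, and the only geometric input is the radial
  comparison of a cube with a ball (\<open>Lipschitz_connected_imp_cube_filling\<close>,
  \<open>extend_over_cubical_complex\<close>).\<close>

section \<open>Smallest Lipschitz constants\<close>

text \<open>The infimum of the admissible constants is itself admissible, because for \<open>x \<noteq> y\<close> every admissible
  constant is at least the quotient of the two distances.\<close>

lemma Lip_props:
  assumes "Lipschitz_continuous_map X Y f"
  shows Lip_nonneg: "0 \<le> Lip X Y f"
    and Lip_bound: "\<And>x y. x \<in> mspace X \<Longrightarrow> y \<in> mspace X \<Longrightarrow>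
                      mdist Y (f x) (f y) \<le> Lip X Y f * mdist X x y"
proof -
  define S where "S = {L. 0 \<le> L \<and> (\<forall>x\<in>mspace X. \<forall>y\<in>mspace X. mdist Y (f x) (f y) \<le> L * mdist X x y)}"
  have Lip: "Lip X Y f = Inf S"
    by (simp add: Lip_def S_def)
  obtain B where B: "\<forall>x\<in>mspace X. \<forall>y\<in>mspace X. mdist Y (f x) (f y) \<le> B * mdist X x y"
    using assms by (auto simp: Lipschitz_continuous_map_def)
  have "mdist Y (f x) (f y) \<le> \<bar>B\<bar> * mdist X x y" if "x \<in> mspace X" "y \<in> mspace X" for x y
    using B that by (smt (verit) mdist_nonneg mult_right_mono)
  then have ne: "S \<noteq> {}"
    by (auto simp: S_def intro!: exI[of _ "\<bar>B\<bar>"])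
  show "0 \<le> Lip X Y f"
    unfolding Lip using ne by (intro cInf_greatest) (auto simp: S_def)
  fix x y assume xy: "x \<in> mspace X" "y \<in> mspace X"
  show "mdist Y (f x) (f y) \<le> Lip X Y f * mdist X x y"
  proof (cases "mdist X x y = 0")
    case True
    obtain L where "L \<in> S" using ne by auto
    then have "mdist Y (f x) (f y) \<le> L * mdist X x y" using xy by (auto simp: S_def)
    then show ?thesis using True by simp
  next
    case False
    then have pos: "mdist X x y > 0" by (simp add: less_le)
    have "mdist Y (f x) (f y) / mdist X x y \<le> Inf S"
      using ne xy pos by (intro cInf_greatest) (auto simp: S_def divide_le_eq)
    then show ?thesis
      using pos by (simp add: Lip divide_le_eq)
  qed
qed

lemma Lip_le:
  assumes "0 \<le> L"
    and "\<And>x y. x \<in> mspace X \<Longrightarrow> y \<in> mspace X \<Longrightarrow> mdist Y (f x) (f y) \<le> L * mdist X x y"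
  shows "Lip X Y f \<le> L"
  unfolding Lip_def using assms by (intro cInf_lower bdd_belowI[of _ 0]) auto

section \<open>Radial maps between the cube and the ball\<close>

definition max_norm :: "nat \<Rightarrow> (nat \<Rightarrow> real) \<Rightarrow> real" where
  "max_norm N x = Max ((\<lambda>i. \<bar>x i\<bar>) ` {..<N})"

lemma abs_le_max_norm: "i < N \<Longrightarrow> \<bar>x i\<bar> \<le> max_norm N x"
  by (simp add: max_norm_def)

lemma max_norm_le: "0 < N \<Longrightarrow> (\<And>i. i < N \<Longrightarrow> \<bar>x i\<bar> \<le> b) \<Longrightarrow> max_norm N x \<le> b"
  unfolding max_norm_def by (subst Max_le_iff) (auto simp: lessThan_empty_iff)

lemma max_norm_attained: "0 < N \<Longrightarrow> \<exists>i<N. max_norm N x = \<bar>x i\<bar>"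
proof -
  assume "0 < N"
  then have "max_norm N x \<in> (\<lambda>i. \<bar>x i\<bar>) ` {..<N}"
    unfolding max_norm_def by (intro Max_in) (auto simp: lessThan_empty_iff)
  then show ?thesis by auto
qed

lemma max_norm_nonneg: "0 < N \<Longrightarrow> 0 \<le> max_norm N x"
  using max_norm_attained[of N x] by auto

lemma max_norm_diff: "0 < N \<Longrightarrow> \<bar>max_norm N x - max_norm N y\<bar> \<le> max_norm N (\<lambda>i. x i - y i)"
proof -
  assume N: "0 < N"
  have "max_norm N x \<le> max_norm N y + max_norm N (\<lambda>i. x i - y i)"
    using abs_le_max_norm[of _ N y] abs_le_max_norm[of _ N "\<lambda>i. x i - y i"]
    by (intro max_norm_le[OF N]) (smt (verit))
  moreover have "max_norm N y \<le> max_norm N x + max_norm N (\<lambda>i. x i - y i)"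
    using abs_le_max_norm[of _ N x] abs_le_max_norm[of _ N "\<lambda>i. x i - y i"]
    by (intro max_norm_le[OF N]) (smt (verit))
  ultimately show ?thesis by linarith
qed

lemma max_norm_scale: "0 < N \<Longrightarrow> max_norm N (\<lambda>i. c * x i) = \<bar>c\<bar> * max_norm N x"
proof (rule antisym)
  assume N: "0 < N"
  show "max_norm N (\<lambda>i. c * x i) \<le> \<bar>c\<bar> * max_norm N x"
    by (intro max_norm_le[OF N]) (auto simp: abs_mult abs_le_max_norm mult_left_mono)
  obtain i where "i < N" "max_norm N x = \<bar>x i\<bar>"
    using max_norm_attained[OF N] by blast
  then show "\<bar>c\<bar> * max_norm N x \<le> max_norm N (\<lambda>i. c * x i)"
    using abs_le_max_norm[of i N "\<lambda>i. c * x i"] by (simp add: abs_mult)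
qed

lemma L2_set_scale: "L2_set (\<lambda>i. c * x i) A = \<bar>c\<bar> * L2_set x A"
proof -
  have "L2_set (\<lambda>i. c * x i) A = L2_set (\<lambda>i. \<bar>c\<bar> * x i) A"
    by (simp add: L2_set_def power_mult_distrib)
  then show ?thesis by (simp add: L2_set_right_distrib)
qed

lemma abs_le_L2_set: "i < (N :: nat) \<Longrightarrow> \<bar>x i\<bar> \<le> L2_set x {..<N}"
proof -
  assume "i < N"
  moreover have "L2_set (\<lambda>i. \<bar>x i\<bar>) {..<N} = L2_set x {..<N}"
    by (simp add: L2_set_def)
  ultimately show ?thesis
    using member_le_L2_set[of "{..<N}" i "\<lambda>i. \<bar>x i\<bar>"] by simp
qed

lemma max_norm_le_L2_set: "0 < N \<Longrightarrow> max_norm N x \<le> L2_set x {..<N}"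
  by (intro max_norm_le abs_le_L2_set)

lemma L2_set_le_max_norm: "L2_set x {..<N} \<le> real N * max_norm N x"
proof -
  have "L2_set x {..<N} \<le> (\<Sum>i<N. \<bar>x i\<bar>)"
    by (rule L2_set_le_sum_abs)
  also have "\<dots> \<le> real N * max_norm N x"
    using sum_bounded_above[of "{..<N}" "\<lambda>i. \<bar>x i\<bar>" "max_norm N x"] by (simp add: abs_le_max_norm)
  finally show ?thesis .
qed

text \<open>Rescaling every ray turns the maximum norm \<open>p\<close> into the Euclidean norm \<open>q\<close>: the map
  \<open>x \<mapsto> (p x / q x) x\<close> carries the cube \<open>p \<le> 1\<close> onto the ball. It is Lipschitz because \<open>p \<le> q\<close> and
  because the change of the factor, multiplied by \<open>q y\<close>, is controlled by the changes of \<open>p\<close> and of \<open>q\<close>.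
  At the origin \<open>0 / 0 = 0\<close> gives the value that the radial map has there.\<close>

lemma cube_to_ball_Lipschitz:
  assumes N: "0 < N"
  shows "L2_set (\<lambda>i. max_norm N x / L2_set x {..<N} * x i - max_norm N y / L2_set y {..<N} * y i) {..<N}
         \<le> 3 * L2_set (\<lambda>i. x i - y i) {..<N}"
proof -
  define q where "q = (\<lambda>x :: nat \<Rightarrow> real. L2_set x {..<N})"
  define a where "a = max_norm N x / q x"
  define b where "b = max_norm N y / q y"
  have q0: "q z \<ge> 0" for z by (simp add: q_def)
  have pq: "0 \<le> max_norm N z" "max_norm N z \<le> q z" for z
    using N by (auto simp: q_def max_norm_nonneg max_norm_le_L2_set)
  have a: "0 \<le> a" "a \<le> 1"
    using pq[of x] by (auto simp: a_def divide_le_eq_1)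
  have qtri: "q (\<lambda>i. u i + v i) \<le> q u + q v" for u v
    by (simp add: q_def L2_set_triangle_ineq)
  have qneg: "q (\<lambda>i. v i - u i) = q (\<lambda>i. u i - v i)" for u v
    by (simp add: q_def L2_set_def power2_commute)
  have qdiff: "\<bar>q x - q y\<bar> \<le> q (\<lambda>i. x i - y i)"
    using qtri[of "\<lambda>i. x i - y i" y] qtri[of "\<lambda>i. y i - x i" x] qneg[of x y] by simp
  have pdiff: "\<bar>max_norm N x - max_norm N y\<bar> \<le> q (\<lambda>i. x i - y i)"
    using max_norm_diff[OF N, of x y] pq(2)[of "\<lambda>i. x i - y i"] by linarith
  have b: "b * q y = max_norm N y"
    using pq[of y] by (cases "q y = 0") (auto simp: b_def)
  have a': "a * q x = max_norm N x"
    using pq[of x] by (cases "q x = 0") (auto simp: a_def)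
  have "\<bar>a - b\<bar> * q y = \<bar>(a - b) * q y\<bar>"
    using q0[of y] by (simp add: abs_mult)
  also have "(a - b) * q y = a * (q y - q x) + (max_norm N x - max_norm N y)"
    using a' b by (simp add: algebra_simps)
  also have "\<bar>\<dots>\<bar> \<le> \<bar>a * (q y - q x)\<bar> + \<bar>max_norm N x - max_norm N y\<bar>"
    by (rule abs_triangle_ineq)
  also have "\<bar>a * (q y - q x)\<bar> \<le> 1 * \<bar>q y - q x\<bar>"
    unfolding abs_mult using a by (intro mult_right_mono) auto
  finally have "\<bar>a - b\<bar> * q y \<le> \<bar>q y - q x\<bar> + \<bar>max_norm N x - max_norm N y\<bar>"
    by simp
  then have ab: "\<bar>a - b\<bar> * q y \<le> 2 * q (\<lambda>i. x i - y i)"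
    using qdiff pdiff by linarith
  have "q (\<lambda>i. a * x i - b * y i) = q (\<lambda>i. a * (x i - y i) + (a - b) * y i)"
    by (simp add: algebra_simps)
  also have "\<dots> \<le> q (\<lambda>i. a * (x i - y i)) + q (\<lambda>i. (a - b) * y i)"
    by (rule qtri)
  also have "\<dots> = a * q (\<lambda>i. x i - y i) + \<bar>a - b\<bar> * q y"
    using a by (simp add: q_def L2_set_scale)
  also have "a * q (\<lambda>i. x i - y i) \<le> 1 * q (\<lambda>i. x i - y i)"
    using a q0 by (intro mult_right_mono) auto
  finally show ?thesis
    using ab by (simp add: q_def a_def b_def)
qed

text \<open>The inverse radial map is only needed on the sphere, where the maximum norm is bounded below by
  \<open>1 / N\<close>; that bound is the source of the factor \<open>N\<close>.\<close>

lemma sphere_to_cube_Lipschitz: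
  assumes N: "0 < N" and x: "L2_set x {..<N} = 1" and y: "L2_set y {..<N} = 1" and i: "i < N"
  shows "\<bar>x i / max_norm N x - y i / max_norm N y\<bar> \<le> 2 * real N * L2_set (\<lambda>i. x i - y i) {..<N}"
proof -
  let ?D = "L2_set (\<lambda>i. x i - y i) {..<N}"
  define a where "a = max_norm N x"
  define b where "b = max_norm N y"
  have a: "1 \<le> real N * a" and b: "1 \<le> real N * b"
    using L2_set_le_max_norm[of x N] L2_set_le_max_norm[of y N] x y by (auto simp: a_def b_def)
  have ab: "a > 0" "b > 0"
    using a b N by (smt (verit) of_nat_0_le_iff mult_nonneg_nonpos)+
  have yb: "\<bar>y i\<bar> \<le> b"
    using i by (simp add: b_def abs_le_max_norm)
  have D: "\<bar>x i - y i\<bar> \<le> ?D" "\<bar>b - a\<bar> \<le> ?D"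
    using i abs_le_L2_set[of i N "\<lambda>i. x i - y i"] max_norm_diff[OF N, of x y]
      max_norm_le_L2_set[OF N, of "\<lambda>i. x i - y i"] by (auto simp: a_def b_def)
  have "x i / a - y i / b = (x i - y i) / a + (y i / b) * ((b - a) / a)"
    using ab by (simp add: field_simps)
  also have "\<bar>\<dots>\<bar> \<le> \<bar>x i - y i\<bar> / a + \<bar>y i / b\<bar> * (\<bar>b - a\<bar> / a)"
    using abs_triangle_ineq[of "(x i - y i) / a" "(y i / b) * ((b - a) / a)"] ab
    by (simp add: abs_mult)
  also have "\<dots> \<le> \<bar>x i - y i\<bar> / a + 1 * (\<bar>b - a\<bar> / a)"
    using yb ab by (intro add_left_mono mult_right_mono) auto
  also have "\<dots> \<le> ?D / a + ?D / a"
    using divide_right_mono[OF D(1), of a] divide_right_mono[OF D(2), of a] ab by simp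
  also have "\<dots> = (1 / a) * (2 * ?D)" by simp
  also have "\<dots> \<le> real N * (2 * ?D)"
    using a ab by (intro mult_right_mono) (auto simp: divide_le_eq)
  finally show ?thesis
    by (simp add: a_def b_def mult.assoc mult.left_commute)
qed

section \<open>Cubes and the filling of their boundaries\<close>

text \<open>Lipschitz maps for the supremum distance. The distance enters through its upper bounds \<open>\<delta>\<close>, so that
  index sets may be infinite and no boundedness has to be carried along.\<close>

definition lip_on :: "'y metric \<Rightarrow> real \<Rightarrow> ('j \<Rightarrow> real) set \<Rightarrow> (('j \<Rightarrow> real) \<Rightarrow> 'y) \<Rightarrow> bool" where
  "lip_on Y L S g \<longleftrightarrow> g \<in> S \<rightarrow> mspace Y \<and>
     (\<forall>u\<in>S. \<forall>v\<in>S. \<forall>\<delta>. (\<forall>j. \<bar>u j - v j\<bar> \<le> \<delta>) \<longrightarrow> mdist Y (g u) (g v) \<le> L * \<delta>)"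

lemma lip_onD:
  "lip_on Y L S g \<Longrightarrow> u \<in> S \<Longrightarrow> v \<in> S \<Longrightarrow> (\<And>j. \<bar>u j - v j\<bar> \<le> \<delta>) \<Longrightarrow> mdist Y (g u) (g v) \<le> L * \<delta>"
  by (simp add: lip_on_def)

lemma lip_on_mem: "lip_on Y L S g \<Longrightarrow> u \<in> S \<Longrightarrow> g u \<in> mspace Y"
  by (auto simp: lip_on_def)

lemma lip_on_mono:
  assumes "lip_on Y L S g" "T \<subseteq> S" "L \<le> L'"
  shows "lip_on Y L' T g"
  unfolding lip_on_def
proof (intro conjI ballI allI impI)
  show "g \<in> T \<rightarrow> mspace Y" using assms by (auto simp: lip_on_def)
  fix u v \<delta> assume uv: "u \<in> T" "v \<in> T" and d: "\<forall>j. \<bar>u j - v j\<bar> \<le> \<delta>"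
  have "0 \<le> \<delta>" using d abs_ge_zero order_trans by blast
  then have "L * \<delta> \<le> L' * \<delta>" using assms(3) by (simp add: mult_right_mono)
  then show "mdist Y (g u) (g v) \<le> L' * \<delta>"
    using lip_onD[OF assms(1), of u v \<delta>] uv d assms(2) by fastforce
qed

lemma lip_on_cong: "lip_on Y L S g \<Longrightarrow> (\<And>u. u \<in> S \<Longrightarrow> g' u = g u) \<Longrightarrow> lip_on Y L S g'"
  unfolding lip_on_def by (auto simp: Pi_iff)

definition free_coords :: "('j \<Rightarrow> real) \<Rightarrow> 'j set" where
  "free_coords u = {j. 0 < u j \<and> u j < 1}"

text \<open>For a family \<open>u\<close> of numbers in \<open>[0,1]\<close>, this is the unique closed face of the standard infinite cube that has
  \<open>u\<close> in its relative interior. A face is thus represented by any of its interior points, and its dimension is the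
  number of free coordinates.\<close>

definition cube :: "('j \<Rightarrow> real) \<Rightarrow> ('j \<Rightarrow> real) set" where
  "cube u = {v. \<forall>j. 0 \<le> v j \<and> v j \<le> 1 \<and> (j \<notin> free_coords u \<longrightarrow> v j = u j)}"

lemma self_in_cube: "(\<And>j. 0 \<le> u j \<and> u j \<le> 1) \<Longrightarrow> u \<in> cube u"
  by (auto simp: cube_def)

lemma cube_range: "v \<in> cube u \<Longrightarrow> 0 \<le> v j \<and> v j \<le> 1"
  by (auto simp: cube_def)

lemma free_coords_in_cube: "v \<in> cube u \<Longrightarrow> free_coords v \<subseteq> free_coords u"
  by (force simp: cube_def free_coords_def)

lemma cube_eq:
  assumes "v \<in> cube u" "free_coords v = free_coords u"
  shows "cube v = cube u"
  using assms unfolding cube_def by auto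

text \<open>Lipschitz connectedness, transported from the pair (ball, sphere) to the pair (cube, boundary). The
  relative boundary of \<open>cube u\<close> consists of the points with fewer free coordinates than \<open>u\<close>.\<close>

definition cube_filling :: "'j itself \<Rightarrow> 'y metric \<Rightarrow> real \<Rightarrow> nat \<Rightarrow> bool" where
  "cube_filling (_ :: 'j itself) Y C m \<longleftrightarrow>
     (\<forall>(u :: 'j \<Rightarrow> real) L g. 0 \<le> L \<longrightarrow> (\<forall>j. 0 \<le> u j \<and> u j \<le> 1) \<longrightarrow> card (free_coords u) = Suc m \<longrightarrow>
        lip_on Y L {v \<in> cube u. free_coords v \<noteq> free_coords u} g \<longrightarrow>
        (\<exists>g'. lip_on Y (C * L) (cube u) g' \<and>
              (\<forall>v\<in>cube u. free_coords v \<noteq> free_coords u \<longrightarrow> g' v = g v)))"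

lemma mspace_sphere: "mspace (unit_sphere m) = {x. (\<forall>i\<ge>Suc m. x i = 0) \<and> L2_set x {..<Suc m} = 1}"
  by (auto simp: unit_sphere_def L2_set_def simp del: sum.lessThan_Suc)

lemma mdist_sphere: "mdist (unit_sphere m) = (\<lambda>x y. L2_set (\<lambda>i. x i - y i) {..<Suc m})"
  by (simp add: unit_sphere_def)

lemma mspace_ball: "mspace (unit_ball N) = {x. (\<forall>i\<ge>N. x i = 0) \<and> L2_set x {..<N} \<le> 1}"
  by (auto simp: unit_ball_def L2_set_def)

lemma mdist_ball: "mdist (unit_ball N) = (\<lambda>x y. L2_set (\<lambda>i. x i - y i) {..<N})"
  by (simp add: unit_ball_def)

text \<open>A boundary map \<open>g\<close> is pulled back to the sphere by the radial map \<open>\<psi>\<close>, extended to the ball, and pulled back to the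
  cube by the radial map \<open>\<theta>\<close>. Since \<open>\<psi> \<circ> \<theta>\<close> is the identity on the boundary of the cube, the result extends \<open>g\<close>.\<close>

lemma Lipschitz_connected_imp_cube_filling:
  assumes "Lipschitz_connected m Y"
  shows "\<exists>C. 1 \<le> C \<and> cube_filling TYPE('j) Y C m"
proof -
  define N where "N = Suc m"
  have N: "0 < N" by (simp add: N_def)
  obtain c where c: "\<And>f. Lipschitz_continuous_map (unit_sphere m) Y f \<Longrightarrow>
        \<exists>g. Lipschitz_continuous_map (unit_ball N) Y g \<and>
             (\<forall>x\<in>mspace (unit_sphere m). g x = f x) \<and>
             Lip (unit_ball N) Y g \<le> c * Lip (unit_sphere m) Y f"
    using assms unfolding Lipschitz_connected_def N_def by auto
  define C where "C = max 1 (max c 0 * real N * (6 * real N))"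
  have "cube_filling TYPE('j) Y C m"
    unfolding cube_filling_def
  proof (intro allI impI)
    fix u :: "'j \<Rightarrow> real" and L g
    assume L: "0 \<le> L" and u: "\<forall>j. 0 \<le> u j \<and> u j \<le> 1" and crd: "card (free_coords u) = Suc m"
      and g: "lip_on Y L {v \<in> cube u. free_coords v \<noteq> free_coords u} g"
    define A where "A = free_coords u"
    have "finite A" using crd card.infinite unfolding A_def by fastforce
    then obtain b where b: "bij_betw b {..<N} A"
      using ex_bij_betw_nat_finite[of A] crd unfolding A_def N_def by (auto simp: atLeast0LessThan)
    define b' where "b' = the_inv_into {..<N} b"
    have b': "b' j < N" "b (b' j) = j" if "j \<in> A" for j
      using b that f_the_inv_into_f_bij_betw[OF b] the_inv_into_into[of b "{..<N}" j "{..<N}"]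
      by (auto simp: b'_def bij_betw_def)
    have bb: "b i \<in> A" "b' (b i) = i" if "i < N" for i
      using b that by (auto simp: b'_def bij_betw_def the_inv_into_f_f)
    define \<psi> where "\<psi> = (\<lambda>x :: nat \<Rightarrow> real. \<lambda>j. if j \<in> A then (1 + x (b' j) / max_norm N x) / 2 else u j)"
    \<comment> \<open>Coordinates on the face, centred so that its boundary becomes the unit sphere of the maximum norm.\<close>
    define w where "w = (\<lambda>v :: 'j \<Rightarrow> real. \<lambda>i. if i < N then 2 * v (b i) - 1 else 0)"
    define \<theta> where "\<theta> = (\<lambda>v i. max_norm N (w v) / L2_set (w v) {..<N} * w v i)"
    have S: "mspace (unit_sphere m) = {x. (\<forall>i\<ge>N. x i = 0) \<and> L2_set x {..<N} = 1}"
      "mdist (unit_sphere m) = (\<lambda>x y. L2_set (\<lambda>i. x i - y i) {..<N})"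
      by (simp_all add: mspace_sphere mdist_sphere N_def del: sum.lessThan_Suc)
    have \<psi>_mem: "\<psi> x \<in> {v \<in> cube u. free_coords v \<noteq> free_coords u}" if x: "x \<in> mspace (unit_sphere m)" for x
    proof -
      have "1 \<le> real N * max_norm N x"
        using L2_set_le_max_norm[of x N] x by (simp add: S)
      then have pos: "0 < max_norm N x" by (smt (verit) of_nat_0_le_iff mult_nonneg_nonpos)
      have bd: "0 \<le> 1 + x i / max_norm N x \<and> x i / max_norm N x \<le> 1" if "i < N" for i
      proof -
        have "\<bar>x i / max_norm N x\<bar> \<le> 1"
          using abs_le_max_norm[OF that, of x] pos by simp
        then show ?thesis by linarith
      qed
      obtain i where i: "i < N" "max_norm N x = \<bar>x i\<bar>"
        using max_norm_attained[OF N] by blast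
      have "\<psi> x (b i) = 0 \<or> \<psi> x (b i) = 1"
        using i pos bb[of i] by (auto simp: \<psi>_def abs_if field_simps split: if_splits)
      then have "b i \<notin> free_coords (\<psi> x)" by (auto simp: free_coords_def)
      moreover have "b i \<in> free_coords u" using bb(1)[OF i(1)] by (simp add: A_def)
      moreover have "\<psi> x \<in> cube u"
        unfolding cube_def using bd b' u by (auto simp: \<psi>_def A_def[symmetric])
      ultimately show ?thesis by auto
    qed
    have \<psi>_lip: "\<bar>\<psi> x j - \<psi> y j\<bar> \<le> real N * mdist (unit_sphere m) x y"
      if "x \<in> mspace (unit_sphere m)" "y \<in> mspace (unit_sphere m)" for x y j
    proof (cases "j \<in> A")
      case True
      then have "\<psi> x j - \<psi> y j = (x (b' j) / max_norm N x - y (b' j) / max_norm N y) / 2"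
        by (simp add: \<psi>_def add_divide_distrib diff_divide_distrib)
      moreover have "\<bar>x (b' j) / max_norm N x - y (b' j) / max_norm N y\<bar>
          \<le> 2 * real N * mdist (unit_sphere m) x y"
        using sphere_to_cube_Lipschitz[OF N, of x y "b' j"] that b'(1)[OF True] by (simp add: S)
      moreover have "\<bar>d\<bar> \<le> r * k" if "d = z / 2" "\<bar>z\<bar> \<le> 2 * r * k" for d z r k :: real
        using that by (simp add: mult.assoc)
      ultimately show ?thesis by blast
    next
      case False
      then show ?thesis by (simp add: \<psi>_def)
    qed
    have f_lip: "mdist Y ((g \<circ> \<psi>) x) ((g \<circ> \<psi>) y) \<le> (L * real N) * mdist (unit_sphere m) x y"
      if "x \<in> mspace (unit_sphere m)" "y \<in> mspace (unit_sphere m)" for x y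
      using lip_onD[OF g \<psi>_mem[OF that(1)] \<psi>_mem[OF that(2)] \<psi>_lip[OF that]] by (simp add: mult.assoc)
    have f: "Lipschitz_continuous_map (unit_sphere m) Y (g \<circ> \<psi>)"
      unfolding Lipschitz_continuous_map_def
      using f_lip lip_on_mem[OF g] \<psi>_mem by (auto simp del: mem_Collect_eq)
    obtain G where G: "Lipschitz_continuous_map (unit_ball N) Y G"
      and Gf: "\<And>x. x \<in> mspace (unit_sphere m) \<Longrightarrow> G x = g (\<psi> x)"
      and GL: "Lip (unit_ball N) Y G \<le> c * Lip (unit_sphere m) Y (g \<circ> \<psi>)"
      using c[OF f] by auto
    have "Lip (unit_sphere m) Y (g \<circ> \<psi>) \<le> L * real N"
      using L f_lip by (intro Lip_le) auto
    then have "c * Lip (unit_sphere m) Y (g \<circ> \<psi>) \<le> max c 0 * (L * real N)"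
      using L Lip_nonneg[OF f] by (intro mult_mono) auto
    then have GL': "Lip (unit_ball N) Y G \<le> max c 0 * (L * real N)"
      using GL by linarith
    have w_bd: "max_norm N (w v) \<le> 1" if "v \<in> cube u" for v
      using cube_range[OF that] by (intro max_norm_le[OF N]) (auto simp: w_def abs_le_iff)
    have \<theta>_mem: "\<theta> v \<in> mspace (unit_ball N)" if "v \<in> cube u" for v
    proof -
      have p: "0 \<le> max_norm N (w v)" using max_norm_nonneg[OF N] .
      have "L2_set (\<theta> v) {..<N} = max_norm N (w v) / L2_set (w v) {..<N} * L2_set (w v) {..<N}"
        unfolding \<theta>_def L2_set_scale using p by simp
      also have "\<dots> \<le> max_norm N (w v)" using p by (simp add: divide_simps)
      finally show ?thesis
        using w_bd[OF that] by (auto simp: mspace_ball \<theta>_def w_def)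
    qed
    have \<theta>_lip: "mdist (unit_ball N) (\<theta> v) (\<theta> v') \<le> 6 * real N * \<delta>" if "\<forall>j. \<bar>v j - v' j\<bar> \<le> \<delta>" for v v' \<delta>
    proof -
      have "mdist (unit_ball N) (\<theta> v) (\<theta> v') \<le> 3 * L2_set (\<lambda>i. w v i - w v' i) {..<N}"
        unfolding mdist_ball \<theta>_def by (rule cube_to_ball_Lipschitz[OF N])
      also have "L2_set (\<lambda>i. w v i - w v' i) {..<N} \<le> real N * max_norm N (\<lambda>i. w v i - w v' i)"
        by (rule L2_set_le_max_norm)
      also have "max_norm N (\<lambda>i. w v i - w v' i) \<le> 2 * \<delta>"
      proof (rule max_norm_le[OF N])
        fix i assume "i < N"
        then show "\<bar>w v i - w v' i\<bar> \<le> 2 * \<delta>" using that[rule_format, of "b i"] by (simp add: w_def)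
      qed
      finally show ?thesis by (simp add: mult_left_mono)
    qed
    have \<psi>\<theta>: "\<theta> v \<in> mspace (unit_sphere m) \<and> \<psi> (\<theta> v) = v"
      if v: "v \<in> cube u" and bd: "free_coords v \<noteq> free_coords u" for v
    proof -
      obtain j where j: "j \<in> A" "j \<notin> free_coords v"
        using free_coords_in_cube[OF v] bd by (auto simp: A_def)
      then have "v j = 0 \<or> v j = 1"
        using cube_range[OF v, of j] by (auto simp: free_coords_def)
      then have "1 \<le> \<bar>w v (b' j)\<bar>" using b'[OF j(1)] by (auto simp: w_def)
      then have p: "max_norm N (w v) = 1"
        using w_bd[OF v] abs_le_max_norm[OF b'(1)[OF j(1)], of "w v"] by linarith
      have q: "1 \<le> L2_set (w v) {..<N}"
        using max_norm_le_L2_set[OF N, of "w v"] p by simp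
      have "max_norm N (\<theta> v) = 1 / L2_set (w v) {..<N}"
        unfolding \<theta>_def max_norm_scale[OF N] using p q by simp
      then have "\<psi> (\<theta> v) j = v j" for j
        using p q b'[of j] v by (auto simp: \<psi>_def \<theta>_def w_def cube_def A_def)
      moreover have "L2_set (\<theta> v) {..<N} = 1"
        unfolding \<theta>_def L2_set_scale using p q by simp
      moreover have "\<forall>i\<ge>N. \<theta> v i = 0" by (simp add: \<theta>_def w_def)
      ultimately show ?thesis by (auto simp: S)
    qed
    have "lip_on Y (C * L) (cube u) (G \<circ> \<theta>)"
      unfolding lip_on_def
    proof (intro conjI ballI allI impI)
      show "G \<circ> \<theta> \<in> cube u \<rightarrow> mspace Y"
        using Lipschitz_continuous_map_image[OF G] \<theta>_mem by auto
      fix v v' \<delta> assume v: "v \<in> cube u" "v' \<in> cube u" and d: "\<forall>j. \<bar>v j - v' j\<bar> \<le> \<delta>"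
      have "0 \<le> \<delta>" using d abs_ge_zero order_trans by blast
      have "mdist Y ((G \<circ> \<theta>) v) ((G \<circ> \<theta>) v') \<le> Lip (unit_ball N) Y G * mdist (unit_ball N) (\<theta> v) (\<theta> v')"
        using Lip_bound[OF G] \<theta>_mem v by simp
      also have "\<dots> \<le> max c 0 * (L * real N) * (6 * real N * \<delta>)"
        using GL' \<theta>_lip[OF d] L by (intro mult_mono) auto
      also have "\<dots> = max c 0 * real N * (6 * real N) * (L * \<delta>)" by simp
      also have "\<dots> \<le> C * (L * \<delta>)"
        using L \<open>0 \<le> \<delta>\<close> by (intro mult_right_mono) (auto simp: C_def)
      finally show "mdist Y ((G \<circ> \<theta>) v) ((G \<circ> \<theta>) v') \<le> C * L * \<delta>" by (simp add: mult.assoc)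
    qed
    moreover have "\<forall>v\<in>cube u. free_coords v \<noteq> free_coords u \<longrightarrow> (G \<circ> \<theta>) v = g v"
      using \<psi>\<theta> Gf by simp
    ultimately show "\<exists>g'. lip_on Y (C * L) (cube u) g' \<and>
              (\<forall>v\<in>cube u. free_coords v \<noteq> free_coords u \<longrightarrow> g' v = g v)" by blast
  qed
  then show ?thesis by (intro exI[of _ C]) (simp add: C_def)
qed

section \<open>Extension over the skeleta of a cubical complex\<close>

lemma close_nonneg: "(\<And>j. \<bar>u j - v j\<bar> \<le> \<delta>) \<Longrightarrow> (0 :: real) \<le> \<delta>"
  by (meson abs_ge_zero order_trans)

text \<open>Two points in adjacent facets are joined through a point of the common face that is no further from
  either of them than they are from each other; two points in opposite facets have distance at least 1, so a detour through a third
  facet costs only a constant factor. A segment has no third facet, which is why the values at its two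
  ends need a hypothesis of their own.\<close>

lemma boundary_Lipschitz:
  fixes g :: "('j \<Rightarrow> real) \<Rightarrow> 'y"
  assumes L: "0 \<le> L"
    and g: "\<And>v. v \<in> cube u \<Longrightarrow> free_coords v \<noteq> free_coords u \<Longrightarrow> lip_on Y L (cube v) g"
    and edge: "\<And>v w. v \<in> cube u \<Longrightarrow> w \<in> cube u \<Longrightarrow> free_coords v = {} \<Longrightarrow> free_coords w = {} \<Longrightarrow>
                 card (free_coords u) = 1 \<Longrightarrow> mdist Y (g v) (g w) \<le> L"
  shows "lip_on Y (3 * L) {v \<in> cube u. free_coords v \<noteq> free_coords u} g"
  unfolding lip_on_def
proof (intro conjI ballI allI impI)
  let ?bd = "{v \<in> cube u. free_coords v \<noteq> free_coords u}"
  have mem: "g v \<in> mspace Y" if "v \<in> ?bd" for v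
  proof -
    have "v \<in> cube u" "free_coords v \<noteq> free_coords u" using that by auto
    then show ?thesis using lip_on_mem[OF g] self_in_cube[of v] cube_range[of v u] by blast
  qed
  then show "g \<in> ?bd \<rightarrow> mspace Y" by blast
  have face: "mdist Y (g v) (g w) \<le> L * \<delta>"
    if v: "v \<in> cube u" "w \<in> cube u" and j: "j \<in> free_coords u" "v j = w j" "v j = 0 \<or> v j = 1"
      and d: "\<And>j. \<bar>v j - w j\<bar> \<le> \<delta>" for v w j \<delta>
  proof -
    \<comment> \<open>The centre of the facet of \<open>cube u\<close> on which coordinate \<open>j\<close> equals \<open>v j\<close>.\<close>
    define z where "z = (\<lambda>i. if i = j then v j else if i \<in> free_coords u then 1/2 else u i)"
    have z: "free_coords z = free_coords u - {j}"
      using j(3) by (auto simp: z_def free_coords_def)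
    have "z \<in> cube u"
      using j v(1) unfolding cube_def by (auto simp: z_def)
    moreover have "v \<in> cube z" "w \<in> cube z"
      using v j z unfolding cube_def by (auto simp: z_def)
    moreover have "free_coords z \<noteq> free_coords u" using z j(1) by auto
    ultimately show ?thesis using lip_onD[OF g, of z v w \<delta>] d by auto
  qed
  fix v w \<delta> assume v: "v \<in> ?bd" and w: "w \<in> ?bd" and d: "\<forall>j. \<bar>v j - w j\<bar> \<le> \<delta>"
  have \<delta>: "0 \<le> \<delta>" using d close_nonneg[of v w] by blast
  have ex: "\<exists>j\<in>free_coords u. x j = 0 \<or> x j = 1" if x: "x \<in> ?bd" for x
  proof -
    obtain j where "j \<in> free_coords u" "j \<notin> free_coords x"
      using x free_coords_in_cube[of x u] by blast
    then show ?thesis using x cube_range[of x u j] by (force simp: free_coords_def)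
  qed
  obtain j where j: "j \<in> free_coords u" "v j = 0 \<or> v j = 1" using ex[OF v] by auto
  obtain k where k: "k \<in> free_coords u" "w k = 0 \<or> w k = 1" using ex[OF w] by auto
  have upd: "x(i := t) \<in> ?bd" if "x \<in> ?bd" "i \<in> free_coords u" "t = 0 \<or> t = 1" for x i t
  proof -
    have "i \<notin> free_coords (x(i := t))" using that(3) by (auto simp: free_coords_def)
    then show ?thesis using that by (auto simp: cube_def)
  qed
  have tri: "mdist Y (g x) (g z) \<le> mdist Y (g x) (g y) + mdist Y (g y) (g z)"
    if "x \<in> ?bd" "y \<in> ?bd" "z \<in> ?bd" for x y z
    using mem that by (intro mdist_triangle) auto
  show "mdist Y (g v) (g w) \<le> 3 * L * \<delta>"
  proof (cases "j = k")
    case False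
    let ?z = "v(k := w k)"
    have z: "?z \<in> ?bd" using upd[OF v k] .
    have "mdist Y (g v) (g ?z) \<le> L * \<delta>"
      using v z j False d \<delta> by (intro face[of _ _ j]) auto
    moreover have "mdist Y (g ?z) (g w) \<le> L * \<delta>"
      using w z k d \<delta> by (intro face[of _ _ k]) auto
    moreover have "0 \<le> L * \<delta>" using L \<delta> by simp
    ultimately show ?thesis using tri[OF v z w] by simp
  next
    case True
    show ?thesis
    proof (cases "v j = w j")
      case eq: True
      then have "mdist Y (g v) (g w) \<le> L * \<delta>"
        using v w j d by (intro face[of _ _ j]) auto
      moreover have "0 \<le> L * \<delta>" using L \<delta> by simp
      ultimately show ?thesis by simp
    next
      case neq: False
      then have "\<bar>v j - w j\<bar> = 1" using j k True by auto
      then have "1 \<le> \<delta>" using d by metis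
      then have L1: "L \<le> L * \<delta>" using L by (simp add: mult_le_cancel_left1)
      show ?thesis
      proof (cases "free_coords u = {j}")
        case edge_u: True
        have "free_coords v = {}" "free_coords w = {}"
          using v w free_coords_in_cube[of v u] free_coords_in_cube[of w u] edge_u by auto
        then have "mdist Y (g v) (g w) \<le> L" using edge[of v w] v w edge_u by simp
        then show ?thesis using L1 L by linarith
      next
        case False
        then obtain l where l: "l \<in> free_coords u" "l \<noteq> j" using j by auto
        let ?v = "v(l := 0)" and ?w = "w(l := 0)"
        have z: "?v \<in> ?bd" "?w \<in> ?bd" using upd[OF v l(1)] upd[OF w l(1)] by auto
        have "mdist Y (g v) (g ?v) \<le> L * 1"
          using v z j l cube_range[of v u] by (intro face[of _ _ j]) (auto simp: abs_le_iff)
        moreover have "mdist Y (g ?v) (g ?w) \<le> L * \<delta>"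
          using z l d \<delta> by (intro face[of _ _ l]) auto
        moreover have "mdist Y (g ?w) (g w) \<le> L * 1"
          using w z k l True cube_range[of w u] by (intro face[of _ _ j]) (auto simp: abs_le_iff)
        ultimately show ?thesis using tri[OF v z(1) w] tri[OF z(1) z(2) w] L1 by linarith
      qed
    qed
  qed
qed

text \<open>A set of points stands for a complex when it contains, with each point, the closed face around that point.\<close>

definition cubical :: "('j \<Rightarrow> real) set \<Rightarrow> bool" where
  "cubical K \<longleftrightarrow> (\<forall>u\<in>K. (\<forall>j. 0 \<le> u j \<and> u j \<le> 1) \<and> cube u \<subseteq> K)"

lemma cubical_self: "cubical K \<Longrightarrow> u \<in> K \<Longrightarrow> u \<in> cube u"
  by (simp add: cubical_def self_in_cube)

text \<open>Distinct cubes of the same dimension meet only in their boundaries, so they can be filled independently.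
  The filling is chosen as a function of the cube as a set of points, because every interior point has to
  select the same one.\<close>

lemma extend_over_skeleton:
  fixes K :: "('j \<Rightarrow> real) set"
  assumes C: "1 \<le> C" "cube_filling TYPE('j) Y C m" and L: "0 \<le> L"
    and K: "cubical K" and S: "cubical S" "S \<subseteq> K"
    and fin: "\<And>u. u \<in> K \<Longrightarrow> finite (free_coords u)"
    and low: "\<And>u. u \<in> K \<Longrightarrow> card (free_coords u) \<le> m \<Longrightarrow> u \<in> S"
    and g: "\<And>u. u \<in> S \<Longrightarrow> lip_on Y L (cube u) g"
    and edge: "\<And>u v w. u \<in> K \<Longrightarrow> v \<in> cube u \<Longrightarrow> w \<in> cube u \<Longrightarrow> free_coords v = {} \<Longrightarrow>
        free_coords w = {} \<Longrightarrow> mdist Y (g v) (g w) \<le> L"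
  shows "\<exists>g'. (\<forall>u\<in>S. g' u = g u) \<and>
           (\<forall>u\<in>K. u \<in> S \<or> card (free_coords u) \<le> Suc m \<longrightarrow> lip_on Y (3 * C * L) (cube u) g')"
proof -
  define Q where "Q = (\<lambda>u. u \<in> K \<and> u \<notin> S \<and> card (free_coords u) = Suc m)"
  have L_le: "L \<le> 3 * C * L" using C(1) L by (simp add: mult_le_cancel_right1)
  have bd: "v \<in> S" if "Q u" "v \<in> cube u" "free_coords v \<noteq> free_coords u" for u v
  proof (rule low)
    show "v \<in> K" using that K by (auto simp: Q_def cubical_def)
    have "free_coords v \<subset> free_coords u" using that free_coords_in_cube by blast
    then have "card (free_coords v) < card (free_coords u)"
      using that(1) fin by (intro psubset_card_mono) (auto simp: Q_def)
    then show "card (free_coords v) \<le> m" using that(1) by (simp add: Q_def)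
  qed
  have fill: "\<exists>E. lip_on Y (3 * C * L) (cube u) E \<and>
                (\<forall>v\<in>cube u. free_coords v \<noteq> free_coords u \<longrightarrow> E v = g v)" if u: "Q u" for u
  proof -
    have "lip_on Y (3 * L) {v \<in> cube u. free_coords v \<noteq> free_coords u} g"
      using u bd[OF u] by (intro boundary_Lipschitz L g edge[of u]) (auto simp: Q_def)
    moreover have "\<forall>j. 0 \<le> u j \<and> u j \<le> 1" using u K by (auto simp: Q_def cubical_def)
    ultimately have "\<exists>E. lip_on Y (C * (3 * L)) (cube u) E \<and>
        (\<forall>v\<in>cube u. free_coords v \<noteq> free_coords u \<longrightarrow> E v = g v)"
      using C(2)[unfolded cube_filling_def, rule_format, of "3 * L" u g] u L by (auto simp: Q_def)
    then show ?thesis by (simp add: ac_simps)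
  qed
  define F where "F = (\<lambda>c. SOME E. \<exists>u. Q u \<and> c = cube u \<and> lip_on Y (3 * C * L) c E \<and>
                (\<forall>v\<in>c. free_coords v \<noteq> free_coords u \<longrightarrow> E v = g v))"
  have F: "lip_on Y (3 * C * L) (cube u) (F (cube u)) \<and>
             (\<forall>v\<in>cube u. free_coords v \<noteq> free_coords u \<longrightarrow> F (cube u) v = g v)" if u: "Q u" for u
  proof -
    have "\<exists>E u'. Q u' \<and> cube u = cube u' \<and> lip_on Y (3 * C * L) (cube u) E \<and>
                (\<forall>v\<in>cube u. free_coords v \<noteq> free_coords u' \<longrightarrow> E v = g v)"
      using fill[OF u] u by blast
    from someI_ex[OF this] obtain u' where u': "Q u'" "cube u = cube u'"
      "lip_on Y (3 * C * L) (cube u) (F (cube u))"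
      "\<forall>v\<in>cube u. free_coords v \<noteq> free_coords u' \<longrightarrow> F (cube u) v = g v"
      unfolding F_def by blast
    have "u \<in> cube u'" "u' \<in> cube u"
      using u u'(1,2) cubical_self[OF K] by (auto simp: Q_def)
    then have "free_coords u' = free_coords u" using free_coords_in_cube by blast
    then show ?thesis using u' by simp
  qed
  define g' where "g' = (\<lambda>v. if v \<in> S then g v else F (cube v) v)"
  have "lip_on Y (3 * C * L) (cube u) g'" if u: "u \<in> K" "u \<in> S \<or> card (free_coords u) \<le> Suc m" for u
  proof (cases "u \<in> S")
    case True
    then have "\<forall>v\<in>cube u. g' v = g v" using S by (auto simp: g'_def cubical_def)
    then show ?thesis
      using lip_on_cong[OF lip_on_mono[OF g[OF True] subset_refl L_le]] by blast
  next
    case False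
    then have Qu: "Q u" using u low[OF u(1)] by (auto simp: Q_def le_Suc_eq)
    have "g' v = F (cube u) v" if v: "v \<in> cube u" for v
    proof (cases "free_coords v = free_coords u")
      case True
      then have eq: "cube v = cube u" using cube_eq v by blast
      have "v \<notin> S"
        using False eq S(1) cubical_self[OF K u(1)] by (auto simp: cubical_def)
      then show ?thesis by (simp add: g'_def eq)
    next
      case ne: False
      then show ?thesis using bd[OF Qu v ne] F[OF Qu] v by (simp add: g'_def)
    qed
    then show ?thesis using lip_on_cong F[OF Qu] by blast
  qed
  then show ?thesis by (intro exI[of _ g']) (auto simp: g'_def)
qed

text \<open>Skeleton by skeleton extension, relative to a subcomplex \<open>S\<close> on which the map is already given. The
  constant grows only with the dimension \<open>N\<close>, not with the number of cubes.\<close>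

lemma extend_over_cubical_complex:
  fixes K :: "('j \<Rightarrow> real) set"
  assumes C: "1 \<le> C" "\<And>m. m < N \<Longrightarrow> cube_filling TYPE('j) Y C m" and L: "0 \<le> L"
    and K: "cubical K" and S: "cubical S" "S \<subseteq> K"
    and fin: "\<And>u. u \<in> K \<Longrightarrow> finite (free_coords u) \<and> card (free_coords u) \<le> N"
    and vert: "\<And>u. u \<in> K \<Longrightarrow> free_coords u = {} \<Longrightarrow> u \<in> S"
    and g: "\<And>u. u \<in> S \<Longrightarrow> lip_on Y L (cube u) g"
    and edge: "\<And>u v w. u \<in> K \<Longrightarrow> v \<in> cube u \<Longrightarrow> w \<in> cube u \<Longrightarrow> free_coords v = {} \<Longrightarrow>
        free_coords w = {} \<Longrightarrow> mdist Y (g v) (g w) \<le> L"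
  shows "\<exists>g'. (\<forall>u\<in>S. g' u = g u) \<and> (\<forall>u\<in>K. lip_on Y ((3 * C) ^ N * L) (cube u) g')"
proof -
  have "\<exists>g'. (\<forall>u\<in>S. g' u = g u) \<and>
          (\<forall>u\<in>K. u \<in> S \<or> card (free_coords u) \<le> m \<longrightarrow> lip_on Y ((3 * C) ^ m * L) (cube u) g')"
    if "m \<le> N" for m
    using that
  proof (induction m)
    case 0
    show ?case
      using vert fin g by (intro exI[of _ g]) auto
  next
    case (Suc m)
    then obtain g1 where g1: "\<And>u. u \<in> S \<Longrightarrow> g1 u = g u"
      "\<And>u. u \<in> K \<Longrightarrow> u \<in> S \<or> card (free_coords u) \<le> m \<Longrightarrow> lip_on Y ((3 * C) ^ m * L) (cube u) g1"
      by auto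
    define T where "T = {u \<in> K. u \<in> S \<or> card (free_coords u) \<le> m}"
    have T: "cubical T"
      unfolding cubical_def
    proof (intro ballI conjI)
      fix u assume u: "u \<in> T"
      then show "\<forall>j. 0 \<le> u j \<and> u j \<le> 1" using K by (auto simp: T_def cubical_def)
      show "cube u \<subseteq> T"
      proof
        fix v assume v: "v \<in> cube u"
        have "v \<in> K" using u v K by (auto simp: T_def cubical_def)
        moreover have "card (free_coords v) \<le> card (free_coords u)"
          using free_coords_in_cube[OF v] fin[of u] u by (auto simp: T_def intro: card_mono)
        ultimately show "v \<in> T" using u v S(1) by (auto simp: T_def cubical_def)
      qed
    qed
    have L': "0 \<le> (3 * C) ^ m * L" "L \<le> (3 * C) ^ m * L"
      using C(1) L one_le_power[of "3 * C" m] by (auto simp: mult_le_cancel_right1)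
    have edge': "mdist Y (g1 v) (g1 w) \<le> (3 * C) ^ m * L"
      if u: "u \<in> K" "v \<in> cube u" "w \<in> cube u" "free_coords v = {}" "free_coords w = {}" for u v w
    proof -
      have "v \<in> K" "w \<in> K" using u K by (auto simp: cubical_def)
      then have "v \<in> S" "w \<in> S" using vert u by blast+
      then show ?thesis using edge[OF u] g1(1) L'(2) by simp
    qed
    have "\<exists>g'. (\<forall>u\<in>T. g' u = g1 u) \<and>
           (\<forall>u\<in>K. u \<in> T \<or> card (free_coords u) \<le> Suc m \<longrightarrow>
                lip_on Y (3 * C * ((3 * C) ^ m * L)) (cube u) g')"
      using Suc.prems fin g1(2) edge' 
      by (intro extend_over_skeleton C L' K T) (auto simp: T_def)
    then obtain g2 where "\<forall>u\<in>T. g2 u = g1 u"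
      "\<forall>u\<in>K. u \<in> T \<or> card (free_coords u) \<le> Suc m \<longrightarrow> lip_on Y (3 * C * ((3 * C) ^ m * L)) (cube u) g2"
      by blast
    then show ?case
      using g1(1) S(2) by (intro exI[of _ g2]) (auto simp: T_def mult.assoc)
  qed
  from this[of N] show ?thesis using fin by auto
qed

section \<open>Cubical realizations of simplicial complexes\<close>

definition supp :: "('i \<Rightarrow> real) \<Rightarrow> 'i set" where
  "supp u = {i. u i \<noteq> 0}"

definition complex_of_dim :: "nat \<Rightarrow> 'i set set \<Rightarrow> bool" where
  "complex_of_dim n D \<longleftrightarrow> (\<forall>S\<in>D. finite S \<and> card S \<le> Suc n \<and> Pow S \<subseteq> D)"

text \<open>The points of the cubical subdivision of the complex: the cube whose coordinates are 1 on \<open>S\<close>, free on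
  \<open>T - S\<close> and 0 elsewhere corresponds to an interval \<open>S \<subseteq> T\<close> of simplices. In contrast to barycentric
  coordinates, a point is obtained from a family of functions with values in \<open>[0,1]\<close> without any
  normalization, as soon as one of them takes the value 1.\<close>

definition realization :: "'i set set \<Rightarrow> ('i \<Rightarrow> real) set" where
  "realization D = {u. (\<forall>i. 0 \<le> u i \<and> u i \<le> 1) \<and> (\<exists>i. u i = 1) \<and> supp u \<in> D}"

lemma supp_in_cube:
  assumes "v \<in> cube u" shows "supp v \<subseteq> supp u"
proof
  fix i assume "i \<in> supp v"
  then have "u i \<noteq> 0" using assms by (cases "i \<in> free_coords u") (auto simp: cube_def supp_def free_coords_def)
  then show "i \<in> supp u" by (simp add: supp_def)
qed

lemma cubical_realization:
  assumes "complex_of_dim n D" shows "cubical (realization D)"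
  unfolding cubical_def
proof (intro ballI conjI subsetI)
  fix u assume u: "u \<in> realization D"
  then show "\<forall>j. 0 \<le> u j \<and> u j \<le> 1" by (simp add: realization_def)
  fix v assume v: "v \<in> cube u"
  obtain i where "u i = 1" using u by (auto simp: realization_def)
  then have "v i = 1" using v by (auto simp: cube_def free_coords_def)
  moreover have "supp v \<in> D"
    using supp_in_cube[OF v] u assms by (auto simp: realization_def complex_of_dim_def)
  ultimately show "v \<in> realization D"
    using cube_range[OF v] by (auto simp: realization_def)
qed

text \<open>One coordinate is equal to 1, hence not free; this makes the dimension drop from the size \<open>n + 1\<close> of the simplices to \<open>n\<close>.\<close>

lemma free_coords_realization:
  assumes "complex_of_dim n D" "u \<in> realization D"
  shows "finite (free_coords u) \<and> card (free_coords u) \<le> n"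
proof -
  obtain i where i: "u i = 1" using assms by (auto simp: realization_def)
  have S: "finite (supp u)" "card (supp u) \<le> Suc n"
    using assms by (auto simp: realization_def complex_of_dim_def)
  have sub: "free_coords u \<subseteq> supp u - {i}"
    using i by (auto simp: free_coords_def supp_def)
  have "card (supp u - {i}) = card (supp u) - 1"
    using i S by (subst card_Diff_singleton) (auto simp: supp_def)
  then show ?thesis
    using S card_mono[OF _ sub] finite_subset[OF sub] by auto
qed

text \<open>Passing through the pointwise maximum \<open>w\<close> of \<open>u\<close> and \<open>v\<close> suffices: a coordinate equal to 1 in \<open>u\<close> is
  equal to 1 in \<open>w\<close> too, so \<open>u\<close> and \<open>w\<close> lie in one cube, and likewise for \<open>v\<close>.\<close>

lemma Lipschitz_on_simplex:
  assumes D: "complex_of_dim n D" and g: "\<And>u. u \<in> realization D \<Longrightarrow> lip_on Y L (cube u) g"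
    and u: "u \<in> realization D" and v: "v \<in> realization D" and uv: "supp u \<union> supp v \<in> D"
    and d: "\<And>j. \<bar>u j - v j\<bar> \<le> \<delta>"
  shows "mdist Y (g u) (g v) \<le> 2 * L * \<delta>"
proof -
  let ?w = "\<lambda>j. max (u j) (v j)"
  have half: "mdist Y (g x) (g ?w) \<le> L * \<delta>"
    if x: "x \<in> realization D" "x = u \<or> x = v" for x
  proof -
    obtain i where i: "x i = 1" using x by (auto simp: realization_def)
    define e where "e = (\<lambda>j. if j = i then 1 else if j \<in> supp u \<union> supp v then 1/2 else 0 :: real)"
    have "supp e = supp u \<union> supp v"
      using i x by (auto simp: e_def supp_def)
    then have e: "e \<in> realization D"
      using uv by (auto simp: realization_def e_def)
    have rng: "0 \<le> u j" "u j \<le> 1" "0 \<le> v j" "v j \<le> 1" for j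
      using u v by (auto simp: realization_def)
    have "x \<in> cube e" "?w \<in> cube e"
      using i x(2) rng by (auto simp: cube_def e_def free_coords_def supp_def max_def intro: antisym)
    moreover have "\<bar>x j - ?w j\<bar> \<le> \<delta>" for j
      using x(2) d[of j] by (auto simp: max_def)
    ultimately show ?thesis by (intro lip_onD[OF g[OF e]])
  qed
  have w: "?w \<in> realization D"
  proof -
    have "?w j = 0 \<longleftrightarrow> u j = 0 \<and> v j = 0" for j
    proof -
      have "0 \<le> u j" "0 \<le> v j" using u v by (auto simp: realization_def)
      then show ?thesis by (auto simp: max_def)
    qed
    then have "supp ?w = supp u \<union> supp v" by (auto simp: supp_def)
    moreover obtain i where "u i = 1" using u by (auto simp: realization_def)
    moreover have "0 \<le> ?w j \<and> ?w j \<le> 1" for j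
      using u v by (auto simp: realization_def max_def)
    ultimately show ?thesis
      using uv unfolding realization_def by (auto intro!: exI[of _ i])
  qed
  have mem: "g x \<in> mspace Y" if "x \<in> realization D" for x
    using lip_on_mem[OF g[OF that]] cubical_self[OF cubical_realization[OF D] that] by blast
  have "mdist Y (g u) (g v) \<le> mdist Y (g u) (g ?w) + mdist Y (g v) (g ?w)"
    using mdist_triangle[of "g u" Y "g ?w" "g v"] mem u v w mdist_commute[of Y "g v"] by simp
  then show ?thesis
    using half[OF u] half[OF v] by simp
qed

text \<open>Points at distance less than 1 need not lie in a common simplex, but their simplices share a vertex, and
  the path from \<open>u\<close> to \<open>v\<close> can be led through the common face.\<close>

lemma Lipschitz_on_realization:
  assumes D: "complex_of_dim n D" and g: "\<And>u. u \<in> realization D \<Longrightarrow> lip_on Y L (cube u) g"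
    and u: "u \<in> realization D" and v: "v \<in> realization D"
    and d: "\<And>j. \<bar>u j - v j\<bar> \<le> \<delta>" "\<delta> < 1"
  shows "mdist Y (g u) (g v) \<le> 4 * L * \<delta>"
proof -
  \<comment> \<open>The minimum of \<open>u\<close> and \<open>v\<close>, pushed up by \<open>\<delta>\<close> on its support so that some coordinate reaches 1.\<close>
  define w where "w = (\<lambda>j. if u j = 0 \<or> v j = 0 then 0 else min 1 (min (u j) (v j) + \<delta>))"
  have \<delta>: "0 \<le> \<delta>" using d close_nonneg[of u v] by blast
  have rng: "0 \<le> u j" "u j \<le> 1" "0 \<le> v j" "v j \<le> 1" for j
    using u v by (auto simp: realization_def)
  have close: "\<bar>u j - w j\<bar> \<le> \<delta>" "\<bar>w j - v j\<bar> \<le> \<delta>" for j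
    using rng[of j] d(1)[of j] \<delta> by (auto simp: w_def min_def abs_le_iff)
  obtain i where i: "u i = 1" using u by (auto simp: realization_def)
  have "w i = 1"
    using i rng[of i] d(1)[of i] d(2) by (auto simp: w_def min_def)
  moreover have "0 \<le> w j \<and> w j \<le> 1" for j
    using rng[of j] \<delta> by (auto simp: w_def)
  moreover have sub: "supp w \<subseteq> supp u" "supp w \<subseteq> supp v"
    by (auto simp: w_def supp_def)
  moreover have su: "supp u \<in> D" "supp v \<in> D"
    using u v by (auto simp: realization_def)
  ultimately have w: "w \<in> realization D"
    using D by (auto simp: realization_def complex_of_dim_def)
  have "supp u \<union> supp w \<in> D" "supp w \<union> supp v \<in> D"
    using sub su by (simp_all add: sup.absorb1 sup.absorb2)
  then have "mdist Y (g u) (g w) \<le> 2 * L * \<delta>" "mdist Y (g w) (g v) \<le> 2 * L * \<delta>"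
    using Lipschitz_on_simplex[OF D g] u v w close by blast+
  moreover have "g x \<in> mspace Y" if "x \<in> realization D" for x
    using lip_on_mem[OF g[OF that]] cubical_self[OF cubical_realization[OF D] that] by blast
  ultimately show ?thesis
    using mdist_triangle[of "g u" Y "g w" "g v"] u v w by auto
qed

text \<open>The vertices of the subdivision are the simplices. Each of them is sent to the value at one of its own vertices;
  this map of the 0-skeleton is then extended over cubes of dimension at most \<open>n\<close>, that is, from boundary
  spheres of dimension less than \<open>n\<close>.\<close>

lemma realize_vertex_map:
  fixes y :: "'i \<Rightarrow> 'y"
  assumes C: "1 \<le> C" "\<And>m. m < n \<Longrightarrow> cube_filling TYPE('i) Y C m" and L: "0 \<le> L"
    and D: "complex_of_dim n D"
    and y: "\<And>i. i \<in> \<Union>D \<Longrightarrow> y i \<in> mspace Y"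
    and yd: "\<And>S i j. S \<in> D \<Longrightarrow> i \<in> S \<Longrightarrow> j \<in> S \<Longrightarrow> mdist Y (y i) (y j) \<le> L"
  shows "\<exists>g. (\<forall>i. {i} \<in> D \<longrightarrow> g (indicator {i}) = y i) \<and>
           (\<forall>u\<in>realization D. lip_on Y ((3 * C) ^ n * L) (cube u) g)"
proof -
  let ?K = "realization D"
  define S where "S = {u \<in> ?K. free_coords u = {}}"
  define g where "g = (\<lambda>u :: 'i \<Rightarrow> real. y (SOME i. u i = 1))"
  have K: "cubical ?K" using cubical_realization[OF D] .
  have gy: "\<exists>i\<in>supp u. g u = y i" if u: "u \<in> ?K" for u
  proof -
    have "\<exists>i. u i = 1" using u by (auto simp: realization_def)
    from someI_ex[OF this] show ?thesis
      by (intro bexI[of _ "SOME i. u i = 1"]) (auto simp: g_def supp_def)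
  qed
  have cube_vertex: "cube u = {u}" if "u \<in> S" for u
    using that by (auto simp: S_def cube_def realization_def)
  have S: "cubical S"
    using K cube_vertex by (auto simp: cubical_def S_def)
  have lip: "lip_on Y L (cube u) g" if "u \<in> S" for u
  proof -
    have "u \<in> ?K" using that by (simp add: S_def)
    then obtain i where "i \<in> supp u" "g u = y i" "supp u \<in> D"
      using gy[of u] by (auto simp: realization_def)
    then have "g u \<in> mspace Y" using y[of i] by auto
    moreover have "mdist Y (g u) (g u) \<le> L * \<delta>" if "0 \<le> \<delta>" for \<delta>
      using calculation L that mdist_zero[of "g u" Y "g u"] by (metis mult_nonneg_nonneg)
    ultimately show ?thesis
      by (simp add: lip_on_def cube_vertex[OF that])
  qed
  have edge: "mdist Y (g v) (g w) \<le> L" if "u \<in> ?K" "v \<in> cube u" "w \<in> cube u" for u v w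
  proof -
    have "v \<in> ?K" "w \<in> ?K" using that K by (auto simp: cubical_def)
    then obtain i j where "i \<in> supp v" "g v = y i" "j \<in> supp w" "g w = y j"
      using gy by meson
    moreover have "supp v \<subseteq> supp u" "supp w \<subseteq> supp u" "supp u \<in> D"
      using supp_in_cube that by (auto simp: realization_def)
    ultimately show ?thesis using yd[of "supp u" i j] by auto
  qed
  have "\<exists>g'. (\<forall>u\<in>S. g' u = g u) \<and> (\<forall>u\<in>?K. lip_on Y ((3 * C) ^ n * L) (cube u) g')"
  proof (rule extend_over_cubical_complex[OF C L K S])
    show "mdist Y (g v) (g w) \<le> L" if "u \<in> ?K" "v \<in> cube u" "w \<in> cube u" for u v w
      using edge[OF that] .
  qed (use lip free_coords_realization[OF D] in \<open>auto simp: S_def\<close>)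
  then obtain g' where g': "\<forall>u\<in>S. g' u = g u" "\<forall>u\<in>?K. lip_on Y ((3 * C) ^ n * L) (cube u) g'"
    by blast
  have "g' (indicator {i}) = y i" if i: "{i} \<in> D" for i
  proof -
    have "supp (indicator {i}) = {i}" by (auto simp: supp_def indicator_def)
    then have "indicator {i} \<in> S"
      using i by (auto simp: S_def realization_def free_coords_def indicator_def)
    moreover have "(SOME j. indicator {i} j = (1 :: real)) = i"
      by (rule some_equality) (auto simp: indicator_def split: if_splits)
    ultimately show ?thesis using g'(1) by (simp add: g_def)
  qed
  then show ?thesis using g'(2) by blast
qed

text \<open>The time parameter becomes an additional coordinate, indexed by \<open>None\<close>, so the prism over the complex is
  again cubical, of dimension at most \<open>n + 1\<close>. The two given maps live on the subcomplex formed by top and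
  bottom, and the fillings needed are those of spheres of dimension at most \<open>n\<close>.\<close>

lemma Lipschitz_homotopy:
  fixes g0 g1 :: "('i \<Rightarrow> real) \<Rightarrow> 'y"
  assumes C: "1 \<le> C" "\<And>m. m \<le> n \<Longrightarrow> cube_filling TYPE('i option) Y C m" and L: "0 \<le> L"
    and D: "complex_of_dim n D"
    and g0: "\<And>u. u \<in> realization D \<Longrightarrow> lip_on Y L (cube u) g0"
    and g1: "\<And>u. u \<in> realization D \<Longrightarrow> lip_on Y L (cube u) g1"
    and g01: "\<And>u. u \<in> realization D \<Longrightarrow> mdist Y (g0 u) (g1 u) \<le> L"
  shows "\<exists>H. (\<forall>u\<in>realization D. H u 0 = g0 u \<and> H u 1 = g1 u) \<and>
           (\<forall>t. 0 \<le> t \<and> t \<le> 1 \<longrightarrow>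
              (\<forall>u\<in>realization D. lip_on Y ((3 * C) ^ Suc n * (2 * L)) (cube u) (\<lambda>v. H v t))) \<and>
           (\<forall>u\<in>realization D. \<forall>t t'. 0 \<le> t \<and> t \<le> 1 \<and> 0 \<le> t' \<and> t' \<le> 1 \<longrightarrow>
              mdist Y (H u t) (H u t') \<le> (3 * C) ^ Suc n * (2 * L) * \<bar>t - t'\<bar>)"
proof -
  let ?K = "realization D"
  \<comment> \<open>\<open>P\<close> is the prism and \<open>S\<close> the union of its bottom and its top.\<close>
  define P where "P = {z :: 'i option \<Rightarrow> real. (\<lambda>i. z (Some i)) \<in> ?K \<and> 0 \<le> z None \<and> z None \<le> 1}"
  define S where "S = {z \<in> P. z None = 0 \<or> z None = 1}"
  define g where "g = (\<lambda>z :: 'i option \<Rightarrow> real. if z None = 0 then g0 (\<lambda>i. z (Some i)) else g1 (\<lambda>i. z (Some i)))"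
  let ?A = "(3 * C) ^ Suc n * (2 * L)"
  have K: "cubical ?K" using cubical_realization[OF D] .
  have base: "(\<lambda>i. v (Some i)) \<in> cube (\<lambda>i. z (Some i))" if "v \<in> cube z" for v z :: "'i option \<Rightarrow> real"
    using that by (auto simp: cube_def free_coords_def)
  have level: "v None = z None" if "v \<in> cube z" "z None = 0 \<or> z None = 1" for v z :: "'i option \<Rightarrow> real"
    using that by (auto simp: cube_def free_coords_def)
  have P: "cubical P"
    unfolding cubical_def
  proof (intro ballI conjI subsetI)
    fix z assume z: "z \<in> P"
    show "\<forall>j. 0 \<le> z j \<and> z j \<le> 1"
    proof
      fix j show "0 \<le> z j \<and> z j \<le> 1"
        using z by (cases j) (auto simp: P_def realization_def)
    qed
    fix v assume v: "v \<in> cube z"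
    have "(\<lambda>i. v (Some i)) \<in> ?K" using base[OF v] z K by (auto simp: P_def cubical_def)
    then show "v \<in> P" using cube_range[OF v] by (auto simp: P_def)
  qed
  have S: "cubical S"
    using P level unfolding cubical_def by (fastforce simp: S_def)
  have fin: "finite (free_coords z) \<and> card (free_coords z) \<le> Suc n" if "z \<in> P" for z
  proof -
    let ?F = "free_coords (\<lambda>i. z (Some i))"
    have F: "finite ?F" "card ?F \<le> n"
      using free_coords_realization[OF D] that by (auto simp: P_def)
    have sub: "free_coords z \<subseteq> insert None (Some ` ?F)"
    proof
      fix j assume "j \<in> free_coords z"
      then show "j \<in> insert None (Some ` ?F)" by (cases j) (auto simp: free_coords_def)
    qed
    have "card (insert None (Some ` ?F)) \<le> Suc n"
      using F by (simp add: card_insert_if card_image)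
    then show ?thesis
      using card_mono[OF _ sub] finite_subset[OF sub] F(1) by (meson finite.insertI finite_imageI le_trans)
  qed
  have vert: "z \<in> S" if "z \<in> P" "free_coords z = {}" for z
  proof -
    have "None \<notin> free_coords z" using that by simp
    then show ?thesis using that(1) by (force simp: S_def P_def free_coords_def)
  qed
  have lip: "lip_on Y (2 * L) (cube z) g" if z: "z \<in> S" for z
  proof -
    let ?z = "\<lambda>i. z (Some i)"
    have zK: "?z \<in> ?K" and zN: "z None = 0 \<or> z None = 1" using z by (auto simp: S_def P_def)
    define h where "h = (if z None = 0 then g0 else g1)"
    have h: "lip_on Y (2 * L) (cube ?z) h"
      using lip_on_mono[OF g0[OF zK] subset_refl, of "2 * L"]
        lip_on_mono[OF g1[OF zK] subset_refl, of "2 * L"] L by (simp add: h_def)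
    have gh: "g v = h (\<lambda>i. v (Some i))" if "v \<in> cube z" for v
      using level[OF that zN] by (simp add: g_def h_def)
    show ?thesis
      unfolding lip_on_def
    proof (intro conjI ballI allI impI)
      show "g \<in> cube z \<rightarrow> mspace Y" using gh lip_on_mem[OF h base] by auto
      fix v w \<delta> assume "v \<in> cube z" "w \<in> cube z" "\<forall>j. \<bar>v j - w j\<bar> \<le> \<delta>"
      then show "mdist Y (g v) (g w) \<le> 2 * L * \<delta>"
        using gh lip_onD[OF h base base] by simp
    qed
  qed
  have edge: "mdist Y (g v) (g w) \<le> 2 * L"
    if z: "z \<in> P" "v \<in> cube z" "w \<in> cube z" for z v w
  proof -
    let ?z = "\<lambda>i. z (Some i)" and ?v = "\<lambda>i. v (Some i)" and ?w = "\<lambda>i. w (Some i)"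
    have zK: "?z \<in> ?K" using z by (simp add: P_def)
    have vK: "?v \<in> ?K" "?w \<in> ?K" using base[OF z(2)] base[OF z(3)] zK K unfolding cubical_def by blast+
    have one: "\<bar>?v i - ?w i\<bar> \<le> 1" for i
      using cube_range[OF z(2), of "Some i"] cube_range[OF z(3), of "Some i"] by (simp add: abs_le_iff)
    have mem: "g0 x \<in> mspace Y" "g1 x \<in> mspace Y" if "x \<in> ?K" for x
      using lip_on_mem[OF g0] lip_on_mem[OF g1] cubical_self[OF K] that by blast+
    have L0: "mdist Y (g0 ?v) (g0 ?w) \<le> L" and L1: "mdist Y (g1 ?v) (g1 ?w) \<le> L"
      using lip_onD[OF g0[OF zK] base[OF z(2)] base[OF z(3)] one]
        lip_onD[OF g1[OF zK] base[OF z(2)] base[OF z(3)] one] by auto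
    have c: "mdist Y (g0 ?v) (g1 ?w) \<le> 2 * L" "mdist Y (g1 ?v) (g0 ?w) \<le> 2 * L"
      using mdist_triangle[of "g0 ?v" Y "g1 ?v" "g1 ?w"] mdist_triangle[of "g1 ?v" Y "g1 ?w" "g0 ?w"]
        mem vK g01[OF vK(1)] g01[OF vK(2)] L1 mdist_commute[of Y "g1 ?w" "g0 ?w"] by auto
    show ?thesis using L0 L1 L c by (auto simp: g_def)
  qed
  obtain G where G: "\<forall>z\<in>S. G z = g z" "\<And>z. z \<in> P \<Longrightarrow> lip_on Y ?A (cube z) G"
    using extend_over_cubical_complex[of C "Suc n" Y "2 * L" P S g] C L P S fin vert lip edge
    by (auto simp: S_def less_Suc_eq_le)
  define H where "H = (\<lambda>u t. G (case_option t u))"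
  have prism: "case_option (1/2) u \<in> P" if "u \<in> ?K" for u
    using that by (simp add: P_def)
  have in_prism: "case_option t v \<in> cube (case_option (1/2) u)"
    if "v \<in> cube u" "0 \<le> t" "t \<le> 1" for u v and t :: real
    using that by (auto simp: cube_def free_coords_def split: option.split)
  have "H u 0 = g0 u \<and> H u 1 = g1 u" if "u \<in> ?K" for u
    using G(1) that by (simp add: H_def S_def P_def g_def)
  moreover have "lip_on Y ?A (cube u) (\<lambda>v. H v t)" if t: "0 \<le> t" "t \<le> 1" and u: "u \<in> ?K" for t u
    unfolding lip_on_def
  proof (intro conjI ballI allI impI)
    show "(\<lambda>v. H v t) \<in> cube u \<rightarrow> mspace Y"
      using lip_on_mem[OF G(2)[OF prism[OF u]] in_prism] t by (auto simp: H_def)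
    fix v w \<delta> assume v: "v \<in> cube u" "w \<in> cube u" and d: "\<forall>j. \<bar>v j - w j\<bar> \<le> \<delta>"
    have "0 \<le> \<delta>" using close_nonneg[of v w] d by blast
    then show "mdist Y (H v t) (H w t) \<le> ?A * \<delta>"
      unfolding H_def using d
      by (intro lip_onD[OF G(2)[OF prism[OF u]] in_prism in_prism] v t) (auto split: option.split)
  qed
  moreover have "mdist Y (H u t) (H u t') \<le> ?A * \<bar>t - t'\<bar>"
    if u: "u \<in> ?K" and t: "0 \<le> t" "t \<le> 1" "0 \<le> t'" "t' \<le> 1" for u t t'
    unfolding H_def
    by (intro lip_onD[OF G(2)[OF prism[OF u]] in_prism in_prism] cubical_self[OF K u] t)
      (auto split: option.split)
  ultimately show ?thesis by (intro exI[of _ H]) auto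
qed

section \<open>Passing from one scale to the next\<close>

text \<open>The map of realizations induced by a simplicial map \<open>p\<close>. Inserting 0 gives the vertices outside the image of \<open>p\<close>
  the coordinate 0.\<close>

definition push :: "('i \<Rightarrow> 'k) \<Rightarrow> ('i \<Rightarrow> real) \<Rightarrow> 'k \<Rightarrow> real" where
  "push p u = (\<lambda>k. Sup (insert 0 (u ` {i. p i = k})))"

lemma
  assumes "\<And>i. 0 \<le> u i \<and> u i \<le> 1"
  shows push_nonneg: "0 \<le> push p u k"
    and push_ge: "u i \<le> push p u (p i)"
proof -
  have "bdd_above (insert 0 (u ` {i. p i = k}))" for k
    using assms by (intro bdd_aboveI[of _ 1]) auto
  then show "0 \<le> push p u k" "u i \<le> push p u (p i)"
    unfolding push_def by (auto intro!: cSup_upper)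
qed

lemma push_least:
  assumes "0 \<le> b" "\<And>i. p i = k \<Longrightarrow> u i \<le> b"
  shows "push p u k \<le> b"
  unfolding push_def using assms by (intro cSup_least) auto

lemma supp_push:
  assumes "\<And>i. 0 \<le> u i \<and> u i \<le> 1"
  shows "supp (push p u) \<subseteq> p ` supp u"
proof
  fix k assume k: "k \<in> supp (push p u)"
  show "k \<in> p ` supp u"
  proof (rule ccontr)
    assume "k \<notin> p ` supp u"
    then have "push p u k \<le> 0" by (intro push_least) (auto simp: supp_def)
    then show False using k push_nonneg[of u p k] assms by (simp add: supp_def)
  qed
qed

lemma push_close:
  assumes u: "\<And>i. 0 \<le> u i \<and> u i \<le> 1" and v: "\<And>i. 0 \<le> v i \<and> v i \<le> 1"
    and d: "\<And>i. \<bar>u i - v i\<bar> \<le> \<delta>"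
  shows "\<bar>push p u k - push p v k\<bar> \<le> \<delta>"
proof -
  have one_sided: "push p u k \<le> push p v k + \<delta>"
    if u: "\<And>i. 0 \<le> u i \<and> u i \<le> 1" and v: "\<And>i. 0 \<le> v i \<and> v i \<le> 1" and d: "\<And>i. \<bar>u i - v i\<bar> \<le> \<delta>"
    for u v :: "'a \<Rightarrow> real"
  proof (rule push_least)
    show "0 \<le> push p v k + \<delta>"
      using push_nonneg[of v p k] v close_nonneg[OF d] by simp
    fix i assume "p i = k"
    then have "v i \<le> push p v k" using push_ge[of v i p] v by simp
    then show "u i \<le> push p v k + \<delta>" using d[of i] by linarith
  qed
  show ?thesis
    using one_sided[of u v] one_sided[of v u] u v d by (auto simp: abs_le_iff abs_minus_commute)
qed

lemma complex_face: "complex_of_dim n D \<Longrightarrow> S \<in> D \<Longrightarrow> T \<subseteq> S \<Longrightarrow> T \<in> D"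
  by (auto simp: complex_of_dim_def)

lemma push_realization:
  assumes D': "complex_of_dim n D'" and p: "\<And>S. S \<in> D \<Longrightarrow> p ` S \<in> D'" and u: "u \<in> realization D"
  shows "push p u \<in> realization D'"
proof -
  have rng: "\<And>i. 0 \<le> u i \<and> u i \<le> 1" using u by (auto simp: realization_def)
  obtain i where "u i = 1" using u by (auto simp: realization_def)
  then have ge: "1 \<le> push p u (p i)" using push_ge[of u i p] rng by simp
  have le: "push p u k \<le> 1" for k using rng by (intro push_least) auto
  have "p ` supp u \<in> D'" using p u by (simp add: realization_def)
  then have "supp (push p u) \<in> D'"
    by (rule complex_face[OF D']) (use supp_push[of u p] rng in blast)
  moreover have "0 \<le> push p u k" for k using push_nonneg[of u p k] rng by blast
  moreover have "push p u (p i) = 1" using ge le[of "p i"] by simp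
  ultimately show ?thesis
    using le unfolding realization_def by blast
qed

text \<open>A path, for \<open>1 \<le> t \<le> 3\<close>, from \<open>u\<close> to \<open>v\<close> inside the realization: up to time 2 the coordinates of \<open>v\<close>
  are switched on, afterwards those of \<open>u\<close> are switched off. At every time one of the two points has its
  full weight, so some coordinate is equal to 1.\<close>

definition blend :: "real \<Rightarrow> ('k \<Rightarrow> real) \<Rightarrow> ('k \<Rightarrow> real) \<Rightarrow> 'k \<Rightarrow> real" where
  "blend t u v = (\<lambda>k. max (min 1 (3 - t) * u k) (min 1 (t - 1) * v k))"

lemma supp_blend:
  assumes "1 \<le> t" "t \<le> 3"
  shows "supp (blend t u v) \<subseteq> supp u \<union> supp v"
  by (auto simp: supp_def blend_def)

lemma blend_realization:
  assumes D: "complex_of_dim n D" and u: "u \<in> realization D" and v: "v \<in> realization D"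
    and uv: "supp u \<union> supp v \<in> D" and t: "1 \<le> t" "t \<le> 3"
  shows "blend t u v \<in> realization D"
proof -
  obtain i j where i: "u i = 1" and j: "v j = 1" using u v by (auto simp: realization_def)
  have rng: "0 \<le> u k" "u k \<le> 1" "0 \<le> v k" "v k \<le> 1" for k
    using u v by (auto simp: realization_def)
  have c: "0 \<le> min 1 (3 - t)" "min 1 (3 - t) \<le> 1" "0 \<le> min 1 (t - 1)" "min 1 (t - 1) \<le> 1"
    using t by auto
  have r: "0 \<le> blend t u v k" "blend t u v k \<le> 1" for k
    unfolding blend_def using c rng[of k] by (auto intro: mult_le_one simp: le_max_iff_disj)
  have "\<exists>k. blend t u v k = 1"
  proof (cases "t \<le> 2")
    case True
    then have "1 \<le> blend t u v i" using i by (simp add: blend_def)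
    then show ?thesis using r(2)[of i] by (intro exI[of _ i]) simp
  next
    case False
    then have "1 \<le> blend t u v j" using j by (simp add: blend_def)
    then show ?thesis using r(2)[of j] by (intro exI[of _ j]) simp
  qed
  moreover have "supp (blend t u v) \<in> D"
    using supp_blend[OF t, of u v] uv complex_face[OF D] by blast
  ultimately show ?thesis using r by (auto simp: realization_def)
qed

lemma mult_close:
  fixes a b x y :: real
  assumes "0 \<le> x" "x \<le> 1" shows "\<bar>a * x - b * x\<bar> \<le> \<bar>a - b\<bar>"
proof -
  have "\<bar>a * x - b * x\<bar> = \<bar>a - b\<bar> * x"
    using assms(1) by (simp add: left_diff_distrib[symmetric] abs_mult)
  also have "\<dots> \<le> \<bar>a - b\<bar> * 1" using assms by (intro mult_left_mono) auto
  finally show ?thesis by simp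
qed

lemma max_close:
  fixes a b :: real
  assumes "\<bar>a - a'\<bar> \<le> \<delta>" "\<bar>b - b'\<bar> \<le> \<delta>"
  shows "\<bar>max a b - max a' b'\<bar> \<le> \<delta>"
  using assms by linarith

lemma blend_close_time:
  assumes "0 \<le> u k" "u k \<le> 1" "0 \<le> v k" "v k \<le> 1"
  shows "\<bar>blend t u v k - blend t' u v k\<bar> \<le> \<bar>t - t'\<bar>"
proof -
  have "\<bar>min 1 (3 - t) * u k - min 1 (3 - t') * u k\<bar> \<le> \<bar>t - t'\<bar>"
    using mult_close[OF assms(1,2), of "min 1 (3 - t)" "min 1 (3 - t')"] by linarith
  moreover have "\<bar>min 1 (t - 1) * v k - min 1 (t' - 1) * v k\<bar> \<le> \<bar>t - t'\<bar>"
    using mult_close[OF assms(3,4), of "min 1 (t - 1)" "min 1 (t' - 1)"] by linarith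
  ultimately show ?thesis unfolding blend_def by (rule max_close)
qed

lemma blend_close:
  assumes t: "1 \<le> t" "t \<le> 3" and d: "\<bar>u k - u' k\<bar> \<le> \<delta>" "\<bar>v k - v' k\<bar> \<le> \<delta>"
  shows "\<bar>blend t u v k - blend t u' v' k\<bar> \<le> \<delta>"
proof -
  have "\<bar>min 1 (3 - t) * u k - min 1 (3 - t) * u' k\<bar> \<le> \<delta>"
    using mult_close[of "min 1 (3 - t)" "u k" "u' k"] t d by (simp add: mult.commute)
  moreover have "\<bar>min 1 (t - 1) * v k - min 1 (t - 1) * v' k\<bar> \<le> \<delta>"
    using mult_close[of "min 1 (t - 1)" "v k" "v' k"] t d by (simp add: mult.commute)
  ultimately show ?thesis unfolding blend_def by (rule max_close)
qed

text \<open>The image of \<open>u\<close> under \<open>push p\<close> and \<open>v\<close> lie in a common simplex, so that they can be blended.\<close>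

definition compatible :: "('i \<Rightarrow> 'k) \<Rightarrow> 'i set set \<Rightarrow> 'k set set \<Rightarrow> ('i \<Rightarrow> real) \<Rightarrow> ('k \<Rightarrow> real) \<Rightarrow> bool" where
  "compatible p D D' u v \<longleftrightarrow> u \<in> realization D \<and> v \<in> realization D' \<and> p ` supp u \<union> supp v \<in> D'"

text \<open>\<open>T u v\<close> is a path in \<open>Y\<close> from \<open>g u\<close> to \<open>g' v\<close>, parametrized by \<open>[0,3]\<close>. It depends in a Lipschitz way on the time
  and, locally, on the pair of compatible points.\<close>

definition transition :: "'y metric \<Rightarrow> real \<Rightarrow> ('i \<Rightarrow> 'k) \<Rightarrow> 'i set set \<Rightarrow> 'k set set \<Rightarrow>
    (('i \<Rightarrow> real) \<Rightarrow> 'y) \<Rightarrow> (('k \<Rightarrow> real) \<Rightarrow> 'y) \<Rightarrow> (('i \<Rightarrow> real) \<Rightarrow> ('k \<Rightarrow> real) \<Rightarrow> real \<Rightarrow> 'y) \<Rightarrow> bool" where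
  "transition Y A p D D' g g' T \<longleftrightarrow>
     (\<forall>u v. compatible p D D' u v \<longrightarrow>
        T u v 0 = g u \<and> T u v 3 = g' v \<and>
        (\<forall>t\<in>{0..3}. T u v t \<in> mspace Y) \<and>
        (\<forall>t\<in>{0..3}. \<forall>t'\<in>{0..3}. mdist Y (T u v t) (T u v t') \<le> A * \<bar>t - t'\<bar>) \<and>
        (\<forall>u' v' \<delta>. \<forall>t\<in>{0..3}. compatible p D D' u' v' \<and> \<delta> < 1 \<and>
           (\<forall>i. \<bar>u i - u' i\<bar> \<le> \<delta>) \<and> (\<forall>k. \<bar>v k - v' k\<bar> \<le> \<delta>) \<longrightarrow>
           mdist Y (T u v t) (T u' v' t) \<le> A * \<delta>))"

text \<open>During the first third, a homotopy from \<open>g\<close> to \<open>g' \<circ> push p\<close> is followed at the fixed point \<open>u\<close>; then \<open>g'\<close>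
  is applied to the path that blends \<open>push p u\<close> into \<open>v\<close>. Although \<open>u\<close> and \<open>v\<close> together have up to
  \<open>2 n + 2\<close> nonzero coordinates, no cube of dimension above \<open>n + 1\<close> has to be filled: the homotopy
  involves \<open>u\<close> and the time only, and the blending happens inside the second complex.\<close>

lemma transition_exists:
  fixes g :: "('i \<Rightarrow> real) \<Rightarrow> 'y" and g' :: "('k \<Rightarrow> real) \<Rightarrow> 'y"
  assumes C: "1 \<le> C" "\<And>m. m \<le> n \<Longrightarrow> cube_filling TYPE('i option) Y C m" and L: "0 \<le> L"
    and D: "complex_of_dim n D" and D': "complex_of_dim n D'" and p: "\<And>S. S \<in> D \<Longrightarrow> p ` S \<in> D'"
    and g: "\<And>u. u \<in> realization D \<Longrightarrow> lip_on Y L (cube u) g"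
    and g': "\<And>u. u \<in> realization D' \<Longrightarrow> lip_on Y L (cube u) g'"
    and gg': "\<And>u. u \<in> realization D \<Longrightarrow> mdist Y (g u) (g' (push p u)) \<le> 2 * L"
  shows "\<exists>T. transition Y (16 * (3 * C) ^ Suc n * L) p D D' g g' T"
proof -
  define A0 where "A0 = (3 * C) ^ Suc n * (2 * (2 * L))"
  have "1 \<le> (3 * C) ^ Suc n" using C(1) by (intro one_le_power) simp
  then have A0: "2 * L \<le> A0" "0 \<le> A0"
    using L mult_right_mono[of 1 "(3 * C) ^ Suc n" "4 * L"] unfolding A0_def by linarith+
  have K: "cubical (realization D)" using cubical_realization[OF D] .
  have K': "cubical (realization D')" using cubical_realization[OF D'] .
  have rng: "0 \<le> u i \<and> u i \<le> 1" if "u \<in> realization E" for u i and E :: "'j set set"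
    using that by (auto simp: realization_def)
  have memg': "g' u \<in> mspace Y" if "u \<in> realization D'" for u
    using lip_on_mem[OF g'[OF that]] cubical_self[OF K' that] by blast
  have push_lip: "lip_on Y (2 * L) (cube u) (\<lambda>v. g' (push p v))" if u: "u \<in> realization D" for u
    unfolding lip_on_def
  proof (intro conjI ballI allI impI)
    have in_K: "v \<in> realization D" if "v \<in> cube u" for v
      using that u K by (auto simp: cubical_def)
    then show "(\<lambda>v. g' (push p v)) \<in> cube u \<rightarrow> mspace Y"
      using push_realization[OF D' p] memg' by blast
    fix v w \<delta> assume v: "v \<in> cube u" "w \<in> cube u" and d: "\<forall>j. \<bar>v j - w j\<bar> \<le> \<delta>"
    have "p ` supp u \<in> D'" using p u by (auto simp: realization_def)
    moreover have "supp (push p v) \<union> supp (push p w) \<subseteq> p ` supp u"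
      using supp_push[of v p] supp_push[of w p] rng[OF in_K] v supp_in_cube[of _ u]
      by (meson Un_least image_mono subset_trans)
    ultimately have "supp (push p v) \<union> supp (push p w) \<in> D'"
      using complex_face[OF D'] by blast
    moreover have "push p v \<in> realization D'" "push p w \<in> realization D'"
      using push_realization[OF D' p] in_K v by blast+
    moreover have "\<bar>push p v k - push p w k\<bar> \<le> \<delta>" for k
      by (rule push_close) (use cube_range[OF v(1)] cube_range[OF v(2)] d in auto)
    ultimately show "mdist Y (g' (push p v)) (g' (push p w)) \<le> 2 * L * \<delta>"
      by (intro Lipschitz_on_simplex[OF D' g'])
  qed
  have g2: "lip_on Y (2 * L) (cube u) g" if "u \<in> realization D" for u
    using lip_on_mono[OF g[OF that] subset_refl, of "2 * L"] L by simp
  have "0 \<le> 2 * L" using L by simp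
  note homotopy = Lipschitz_homotopy[OF C this D g2 push_lip gg', folded A0_def]
  obtain H where "\<forall>u\<in>realization D. H u 0 = g u \<and> H u 1 = g' (push p u)"
    "\<forall>t. 0 \<le> t \<and> t \<le> 1 \<longrightarrow> (\<forall>u\<in>realization D. lip_on Y A0 (cube u) (\<lambda>v. H v t))"
    "\<forall>u\<in>realization D. \<forall>t t'. 0 \<le> t \<and> t \<le> 1 \<and> 0 \<le> t' \<and> t' \<le> 1 \<longrightarrow>
       mdist Y (H u t) (H u t') \<le> A0 * \<bar>t - t'\<bar>"
    by (rule exE[OF homotopy], assumption+, elim conjE, rule that)
  then have H: "\<And>u. u \<in> realization D \<Longrightarrow> H u 0 = g u \<and> H u 1 = g' (push p u)"
    "\<And>t u. 0 \<le> t \<Longrightarrow> t \<le> 1 \<Longrightarrow> u \<in> realization D \<Longrightarrow> lip_on Y A0 (cube u) (\<lambda>v. H v t)"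
    "\<And>u t t'. u \<in> realization D \<Longrightarrow> 0 \<le> t \<Longrightarrow> t \<le> 1 \<Longrightarrow> 0 \<le> t' \<Longrightarrow> t' \<le> 1 \<Longrightarrow>
       mdist Y (H u t) (H u t') \<le> A0 * \<bar>t - t'\<bar>"
    by simp_all
  define T where "T = (\<lambda>u v t. if t \<le> 1 then H u t else g' (blend t (push p u) v))"
  have "transition Y (4 * A0) p D D' g g' T"
    unfolding transition_def
  proof (intro allI impI conjI ballI)
    fix u v assume uv: "compatible p D D' u v"
    then have u: "u \<in> realization D" and v: "v \<in> realization D'" and S: "p ` supp u \<union> supp v \<in> D'"
      by (auto simp: compatible_def)
    have blend_in: "blend t (push p u) v \<in> realization D'"
      if "compatible p D D' u v" "1 \<le> t" "t \<le> 3" for u v t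
    proof -
      have u: "u \<in> realization D" "v \<in> realization D'" and S: "p ` supp u \<union> supp v \<in> D'"
        using that by (auto simp: compatible_def)
      have "supp (push p u) \<subseteq> p ` supp u" by (rule supp_push) (rule rng[OF u(1)])
      then have "supp (push p u) \<union> supp v \<in> D'"
        by (intro complex_face[OF D' S]) auto
      moreover have "push p u \<in> realization D'" by (rule push_realization[OF D' p u(1)])
      ultimately show ?thesis
        using u that by (intro blend_realization[OF D']) auto
    qed
    have T1: "T u v t = g' (blend t (push p u) v)" if "1 \<le> t" for t
    proof (cases "t = 1")
      case True
      have "blend 1 (push p u) v = push p u"
        using push_nonneg[of u p] rng[OF u] by (auto simp: blend_def)
      then show ?thesis using H(1)[OF u] True by (simp add: T_def)
    qed (use that in \<open>simp add: T_def\<close>)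
    show "T u v 0 = g u" using H(1)[OF u] by (simp add: T_def)
    have "blend 3 (push p u) v = v"
      using rng[OF v] by (auto simp: blend_def)
    then show "T u v 3 = g' v" by (simp add: T_def)
    have mem: "T u v t \<in> mspace Y" if t: "t \<in> {0..3}" for t
    proof (cases "t \<le> 1")
      case True
      then show ?thesis
        using lip_on_mem[OF H(2)[OF _ _ u] cubical_self[OF K u], of t] t by (simp add: T_def)
    next
      case False
      then show ?thesis using memg'[OF blend_in[OF uv]] t by (simp add: T_def)
    qed
    show "T u v t \<in> mspace Y" if t: "t \<in> {0..3}" for t using mem[OF that] .
    have low: "mdist Y (T u v t) (T u v t') \<le> A0 * (t' - t)" if "0 \<le> t" "t \<le> t'" "t' \<le> 1" for t t'
      using H(3)[OF u, of t t'] that by (simp add: T_def)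
    have high: "mdist Y (T u v t) (T u v t') \<le> A0 * (t' - t)" if t: "1 \<le> t" "t \<le> t'" "t' \<le> 3" for t t'
    proof -
      have "supp (blend t (push p u) v) \<union> supp (blend t' (push p u) v) \<subseteq> p ` supp u \<union> supp v"
        using supp_blend[of t "push p u" v] supp_blend[of t' "push p u" v] supp_push[of u p] rng[OF u] t by auto
      then have "supp (blend t (push p u) v) \<union> supp (blend t' (push p u) v) \<in> D'"
        using S complex_face[OF D'] by blast
      then have "mdist Y (g' (blend t (push p u) v)) (g' (blend t' (push p u) v)) \<le> 2 * L * \<bar>t - t'\<bar>"
        using t blend_in[OF uv] rng[OF push_realization[OF D' p u]] rng[OF v]
        by (intro Lipschitz_on_simplex[OF D' g'] blend_close_time) auto
      also have "\<dots> \<le> A0 * (t' - t)"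
        using t A0 by (simp add: mult_right_mono)
      finally show ?thesis using T1 t by simp
    qed
    have ordered: "mdist Y (T u v t) (T u v t') \<le> A0 * (t' - t)" if t: "0 \<le> t" "t \<le> t'" "t' \<le> 3" for t t'
    proof (cases "t' \<le> 1 \<or> 1 \<le> t")
      case False
      have "mdist Y (T u v t) (T u v t') \<le> mdist Y (T u v t) (T u v 1) + mdist Y (T u v 1) (T u v t')"
        using mem t False by (intro mdist_triangle) auto
      also have "\<dots> \<le> A0 * (1 - t) + A0 * (t' - 1)"
        using low[of t 1] high[of 1 t'] t False by (intro add_mono) auto
      finally show ?thesis by (simp add: algebra_simps)
    qed (use low high t in auto)
    have le4: "A0 * s \<le> 4 * A0 * s" if "0 \<le> s" for s
      using that A0 by (simp add: mult_right_mono)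
    show "mdist Y (T u v t) (T u v t') \<le> 4 * A0 * \<bar>t - t'\<bar>" if t: "t \<in> {0..3}" "t' \<in> {0..3}" for t t'
    proof (cases "t \<le> t'")
      case True
      then show ?thesis using ordered[of t t'] t le4[of "t' - t"] by simp
    next
      case False
      then show ?thesis
        using ordered[of t' t] t le4[of "t - t'"] by (simp add: mdist_commute[of Y "T u v t" "T u v t'"])
    qed
    show "mdist Y (T u v t) (T u' v' t) \<le> 4 * A0 * \<delta>"
      if t: "t \<in> {0..3}" and c: "compatible p D D' u' v' \<and> \<delta> < 1 \<and>
           (\<forall>i. \<bar>u i - u' i\<bar> \<le> \<delta>) \<and> (\<forall>k. \<bar>v k - v' k\<bar> \<le> \<delta>)" for u' v' \<delta> t
    proof -
      have u': "u' \<in> realization D" "v' \<in> realization D'" using c by (auto simp: compatible_def)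
      have \<delta>: "0 \<le> \<delta>" using close_nonneg[of u u'] c by blast
      show ?thesis
      proof (cases "t \<le> 1")
        case True
        then show ?thesis
          using Lipschitz_on_realization[OF D H(2)[of t] u u'(1), of \<delta>] t c by (auto simp: T_def)
      next
        case False
        have "\<bar>push p u k - push p u' k\<bar> \<le> \<delta>" for k
          by (rule push_close) (use rng[OF u] rng[OF u'(1)] c in auto)
        then have "mdist Y (g' (blend t (push p u) v)) (g' (blend t (push p u') v')) \<le> 4 * L * \<delta>"
          using t c blend_in[OF uv] blend_in[of u' v'] False
          by (intro Lipschitz_on_realization[OF D' g'] blend_close) auto
        also have "\<dots> \<le> 4 * A0 * \<delta>" using A0 L \<delta> by (intro mult_right_mono) auto
        finally show ?thesis using False by (simp add: T_def)
      qed
    qed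
  qed
  then show ?thesis by (auto simp: A0_def ac_simps)
qed

section \<open>Covers at one scale\<close>

text \<open>The multiplicity bound in the form in which it bounds the dimension of a nerve: members that have
  representatives at mutual distances at most \<open>s\<close> are finitely many, and at most \<open>n + 1\<close>.\<close>

definition good_cover :: "'y metric \<Rightarrow> nat \<Rightarrow> real \<Rightarrow> real \<Rightarrow> 'i set \<Rightarrow> ('i \<Rightarrow> 'y set) \<Rightarrow> bool" where
  "good_cover Y n c s I B \<longleftrightarrow>
     (\<Union>i\<in>I. B i) = mspace Y \<and>
     (\<forall>i\<in>I. B i \<noteq> {} \<and> (\<forall>x\<in>B i. \<forall>y\<in>B i. mdist Y x y \<le> c * s)) \<and>
     (\<forall>S\<subseteq>I. \<forall>z. (\<forall>i\<in>S. z i \<in> B i) \<and> (\<forall>i\<in>S. \<forall>j\<in>S. mdist Y (z i) (z j) \<le> s) \<longrightarrow>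
        finite S \<and> card S \<le> Suc n)"

lemma nagata_dim_imp_good_covers:
  fixes Y :: "'y metric"
  assumes "nagata_dim Y \<le> ereal (real n)"
  shows "\<exists>c>0. \<forall>s>0. \<exists>(I :: 'y set set) B. good_cover Y n c s I B"
proof -
  have "Inf {ereal (of_int k) |k. nagata_property Y k} < ereal (real n + 1)"
    using assms unfolding nagata_dim_def by (rule le_less_trans) simp
  then obtain k where k: "nagata_property Y k" "real_of_int k < real n + 1"
    unfolding Inf_less_iff by auto
  then have kn: "k + 1 \<le> int (Suc n)" by linarith
  obtain c where c: "c > 0" and cov: "\<And>s. s > 0 \<Longrightarrow> \<exists>(I :: 'y set set) B. (\<Union>i\<in>I. B i) = mspace Y \<and>
        bounded_family Y (c * s) I B \<and>
        ereal_of_enat (multiplicity_at_scale Y s I B) \<le> ereal (of_int (k + 1))"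
    using k(1) unfolding nagata_property_def by blast
  have "\<exists>(I :: 'y set set) B. good_cover Y n c s I B" if s: "s > 0" for s
  proof -
    obtain I :: "'y set set" and B where U: "(\<Union>i\<in>I. B i) = mspace Y" and bd: "bounded_family Y (c * s) I B"
      and m: "ereal_of_enat (multiplicity_at_scale Y s I B) \<le> ereal (of_int (k + 1))"
      using cov[OF s] by blast
    define M where "M = {enat q |q. \<forall>A\<subseteq>mspace Y. mdiam Y A \<le> ennreal s \<longrightarrow>
                       finite {i\<in>I. A \<inter> B i \<noteq> {}} \<and> card {i\<in>I. A \<inter> B i \<noteq> {}} \<le> q}"
    have "real_of_int (k + 1) \<le> real (Suc n)" using kn by linarith
    then have "ereal_of_enat (Inf M) \<le> ereal (real (Suc n))"
      using m unfolding multiplicity_at_scale_def M_def by (meson ereal_less_eq(3) order_trans)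
    then have InfM: "Inf M \<le> enat (Suc n)"
      by (cases "Inf M") auto
    \<comment> \<open>The infimum is finite, so the set of admissible bounds is nonempty and its infimum is admissible.\<close>
    have "M \<noteq> {}"
    proof
      assume "M = {}"
      then have "Inf M = \<infinity>" by (simp add: Inf_enat_def)
      then show False using InfM by simp
    qed
    then have "Inf M \<in> M" by (auto simp: Inf_enat_def intro: LeastI)
    then obtain q where q: "q \<le> Suc n" "\<And>A. A\<subseteq>mspace Y \<Longrightarrow> mdiam Y A \<le> ennreal s \<Longrightarrow>
                       finite {i\<in>I. A \<inter> B i \<noteq> {}} \<and> card {i\<in>I. A \<inter> B i \<noteq> {}} \<le> q"
      using InfM by (auto simp: M_def)
    have "good_cover Y n c s {i\<in>I. B i \<noteq> {}} B"
      unfolding good_cover_def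
    proof (intro conjI ballI allI impI)
      show "(\<Union>i\<in>{i \<in> I. B i \<noteq> {}}. B i) = mspace Y" unfolding U[symmetric] by auto
      fix i assume i: "i \<in> {i \<in> I. B i \<noteq> {}}"
      then show "B i \<noteq> {}" by simp
      fix x y assume xy: "x \<in> B i" "y \<in> B i"
      have "ennreal (mdist Y x y) \<le> mdiam Y (B i)"
        unfolding mdiam_def using xy by (intro SUP_upper2[of "(x, y)"]) auto
      also have "\<dots> \<le> ennreal (c * s)" using bd i by (simp add: bounded_family_def)
      finally show "mdist Y x y \<le> c * s" using c s by simp
    next
      fix S z assume S: "S \<subseteq> {i \<in> I. B i \<noteq> {}}"
        and z: "(\<forall>i\<in>S. z i \<in> B i) \<and> (\<forall>i\<in>S. \<forall>j\<in>S. mdist Y (z i) (z j) \<le> s)"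
      have "mdiam Y (z ` S) \<le> ennreal s"
        unfolding mdiam_def using z by (intro SUP_least) (auto simp: ennreal_leI)
      moreover have "z ` S \<subseteq> mspace Y" using z S U by blast
      ultimately have fin: "finite {i\<in>I. z ` S \<inter> B i \<noteq> {}}" "card {i\<in>I. z ` S \<inter> B i \<noteq> {}} \<le> q"
        using q(2)[of "z ` S"] by auto
      have sub: "S \<subseteq> {i\<in>I. z ` S \<inter> B i \<noteq> {}}"
      proof
        fix i assume "i \<in> S"
        then show "i \<in> {i\<in>I. z ` S \<inter> B i \<noteq> {}}" using S z by blast
      qed
      show "finite S" using finite_subset[OF sub fin(1)] .
      show "card S \<le> Suc n" using card_mono[OF fin(1) sub] fin(2) q(1) by linarith
    qed
    then show ?thesis by blast
  qed
  then show ?thesis using c by blast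
qed

text \<open>A nerve at scale \<open>s\<close>: the members of a simplex need not intersect, but only to have representatives at mutual
  distances at most \<open>s\<close>.\<close>

definition nerve :: "'y metric \<Rightarrow> 'i set \<Rightarrow> ('i \<Rightarrow> 'y set) \<Rightarrow> real \<Rightarrow> 'i set set" where
  "nerve Y I B s = {S. S \<subseteq> I \<and> (\<exists>z. (\<forall>i\<in>S. z i \<in> B i) \<and> (\<forall>i\<in>S. \<forall>j\<in>S. mdist Y (z i) (z j) \<le> s))}"

lemma complex_nerve: "good_cover Y n c s I B \<Longrightarrow> complex_of_dim n (nerve Y I B s)"
  unfolding complex_of_dim_def
proof (intro ballI conjI)
  assume G: "good_cover Y n c s I B"
  fix S assume S: "S \<in> nerve Y I B s"
  then show "finite S" "card S \<le> Suc n" using G by (auto simp: nerve_def good_cover_def)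
  show "Pow S \<subseteq> nerve Y I B s"
  proof
    fix T assume "T \<in> Pow S"
    moreover obtain z where "\<forall>i\<in>S. z i \<in> B i" "\<forall>i\<in>S. \<forall>j\<in>S. mdist Y (z i) (z j) \<le> s" "S \<subseteq> I"
      using S by (auto simp: nerve_def)
    ultimately show "T \<in> nerve Y I B s"
      unfolding nerve_def by (intro CollectI conjI exI[of _ z]) blast+
  qed
qed

section \<open>Katetov functions and their coordinates\<close>

text \<open>The functions that can occur as distances from one additional point to the points of \<open>Y\<close>. With the
  supremum distance they form a metric space that contains \<open>Y\<close> isometrically, a point \<open>y\<close> being
  represented by its distance function; the distance between \<open>h\<close> and \<open>y\<close> is then \<open>h y\<close>.\<close>

definition katetov :: "'y metric \<Rightarrow> ('y \<Rightarrow> real) \<Rightarrow> bool" where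
  "katetov Y h \<longleftrightarrow> (\<forall>y\<in>mspace Y. \<forall>z\<in>mspace Y. mdist Y y z \<le> h y + h z \<and> h y \<le> h z + mdist Y y z)"

lemma katetov_nonneg: "katetov Y h \<Longrightarrow> y \<in> mspace Y \<Longrightarrow> 0 \<le> h y"
  unfolding katetov_def using mdist_nonneg[of Y y y] by fastforce

text \<open>The distance from \<open>h\<close>, seen as an additional point, to \<open>Y\<close>.\<close>

definition height :: "'y metric \<Rightarrow> ('y \<Rightarrow> real) \<Rightarrow> real" where
  "height Y h = Inf (h ` mspace Y)"

lemma Inf_image_close:
  fixes h h' :: "'y \<Rightarrow> real"
  assumes "B \<noteq> {}" "\<And>y. y \<in> B \<Longrightarrow> 0 \<le> h y" "\<And>y. y \<in> B \<Longrightarrow> 0 \<le> h' y" "\<And>y. y \<in> B \<Longrightarrow> \<bar>h y - h' y\<bar> \<le> \<delta>"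
  shows "\<bar>Inf (h ` B) - Inf (h' ` B)\<bar> \<le> \<delta>"
proof -
  have one_sided: "Inf (h ` B) - \<delta> \<le> Inf (h' ` B)"
    if "\<And>y. y \<in> B \<Longrightarrow> 0 \<le> h y" "\<And>y. y \<in> B \<Longrightarrow> \<bar>h y - h' y\<bar> \<le> \<delta>" for h h' :: "'y \<Rightarrow> real"
  proof (rule cINF_greatest[OF assms(1)])
    fix y assume y: "y \<in> B"
    have "Inf (h ` B) \<le> h y" using y that(1) by (intro cINF_lower bdd_belowI[of _ 0]) auto
    then show "Inf (h ` B) - \<delta> \<le> h' y" using that(2)[OF y] by linarith
  qed
  have "Inf (h ` B) - \<delta> \<le> Inf (h' ` B)" using assms by (intro one_sided) auto
  moreover have "Inf (h' ` B) - \<delta> \<le> Inf (h ` B)"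
    using assms by (intro one_sided) (auto simp: abs_minus_commute)
  ultimately show ?thesis by linarith
qed

lemma Inf_image_less:
  fixes h :: "'y \<Rightarrow> real"
  assumes "B \<noteq> {}" "Inf (h ` B) < b" shows "\<exists>y\<in>B. h y < b"
  using cInf_lessD[of "h ` B" b] assms by auto

lemma height_le: "katetov Y h \<Longrightarrow> y \<in> mspace Y \<Longrightarrow> height Y h \<le> h y"
  unfolding height_def using katetov_nonneg by (intro cINF_lower bdd_belowI[of _ 0]) auto

lemma height_nonneg: "katetov Y h \<Longrightarrow> mspace Y \<noteq> {} \<Longrightarrow> 0 \<le> height Y h"
  unfolding height_def using katetov_nonneg[of Y h] by (intro cINF_greatest) auto

lemma height_close:
  assumes "katetov Y h" "katetov Y h'" "mspace Y \<noteq> {}" "\<And>y. y \<in> mspace Y \<Longrightarrow> \<bar>h y - h' y\<bar> \<le> \<delta>"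
  shows "\<bar>height Y h - height Y h'\<bar> \<le> \<delta>"
  unfolding height_def using assms katetov_nonneg[OF assms(1)] katetov_nonneg[OF assms(2)]
  by (intro Inf_image_close) auto

text \<open>Bump functions for the enlarged members of a cover: coordinate \<open>i\<close> is 1 at distance at most \<open>a\<close> from
  \<open>B i\<close> and 0 from distance \<open>2 * a\<close> on.\<close>

definition coords :: "'i set \<Rightarrow> ('i \<Rightarrow> 'y set) \<Rightarrow> real \<Rightarrow> ('y \<Rightarrow> real) \<Rightarrow> 'i \<Rightarrow> real" where
  "coords I B a h = (\<lambda>i. if i \<in> I then max 0 (min 1 (2 - Inf (h ` B i) / a)) else 0)"

lemma coords_close:
  assumes G: "good_cover Y n c s I B" and a: "0 < a" and h: "katetov Y h" "katetov Y h'"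
    and d: "\<And>y. y \<in> mspace Y \<Longrightarrow> \<bar>h y - h' y\<bar> \<le> \<delta>" and \<delta>: "0 \<le> \<delta>"
  shows "\<bar>coords I B a h i - coords I B a h' i\<bar> \<le> \<delta> / a"
proof (cases "i \<in> I")
  case True
  then have sub: "B i \<subseteq> mspace Y" "B i \<noteq> {}" using G by (auto simp: good_cover_def)
  have "\<bar>Inf (h ` B i) - Inf (h' ` B i)\<bar> \<le> \<delta>"
    using sub katetov_nonneg[OF h(1)] katetov_nonneg[OF h(2)] d by (intro Inf_image_close) auto
  then have "\<bar>Inf (h ` B i) - Inf (h' ` B i)\<bar> / a \<le> \<delta> / a"
    using a by (intro divide_right_mono) auto
  then have "\<bar>Inf (h ` B i) / a - Inf (h' ` B i) / a\<bar> \<le> \<delta> / a"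
    using a by (simp add: diff_divide_distrib[symmetric])
  then show ?thesis using True by (simp add: coords_def)
qed (use a \<delta> in \<open>simp add: coords_def\<close>)

lemma supp_coords:
  assumes G: "good_cover Y n c s I B" and a: "0 < a" and i: "i \<in> supp (coords I B a h)"
  shows "i \<in> I" "\<exists>z\<in>B i. h z < 2 * a"
proof -
  show I: "i \<in> I" using i by (auto simp: supp_def coords_def split: if_splits)
  have "0 < 2 - Inf (h ` B i) / a" using i I by (auto simp: supp_def coords_def max_def min_def split: if_splits)
  then have "Inf (h ` B i) < 2 * a" using a by (simp add: field_simps)
  then show "\<exists>z\<in>B i. h z < 2 * a"
    using G I by (intro Inf_image_less) (auto simp: good_cover_def)
qed

text \<open>Representatives within distance \<open>2 * a\<close> of \<open>h\<close> are within distance \<open>4 * a\<close> of each other; this explains the scale \<open>4 * a\<close>.\<close>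

lemma nerve_by_height:
  assumes G: "good_cover Y n c s I B" and h: "katetov Y h" and S: "S \<subseteq> I"
    and z: "\<And>i. i \<in> S \<Longrightarrow> \<exists>z\<in>B i. h z \<le> 2 * a"
  shows "S \<in> nerve Y I B (4 * a)"
proof -
  obtain z where z: "\<And>i. i \<in> S \<Longrightarrow> z i \<in> B i \<and> h (z i) \<le> 2 * a"
    using z by metis
  have "mdist Y (z i) (z j) \<le> 4 * a" if "i \<in> S" "j \<in> S" for i j
  proof -
    have "z i \<in> mspace Y" "z j \<in> mspace Y" using z that S G by (auto simp: good_cover_def)
    then have "mdist Y (z i) (z j) \<le> h (z i) + h (z j)" using h by (auto simp: katetov_def)
    then show ?thesis using z[OF that(1)] z[OF that(2)] by linarith
  qed
  then show ?thesis
    unfolding nerve_def using S z by (intro CollectI conjI exI[of _ z]) auto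
qed

lemma coords_realization:
  assumes G: "good_cover Y n c (4 * a) I B" and a: "0 < a" and h: "katetov Y h" and Y: "mspace Y \<noteq> {}"
    and low: "height Y h < a"
  shows "coords I B a h \<in> realization (nerve Y I B (4 * a))"
proof -
  obtain y where y: "y \<in> mspace Y" "h y < a"
    using Inf_image_less[OF Y, of h a] low by (auto simp: height_def)
  then have "y \<in> (\<Union>i\<in>I. B i)" using G by (simp add: good_cover_def)
  then obtain i where i: "i \<in> I" "y \<in> B i" by blast
  have "Inf (h ` B i) \<le> h y"
    using G i katetov_nonneg[OF h] by (intro cINF_lower bdd_belowI[of _ 0]) (auto simp: good_cover_def)
  then have "Inf (h ` B i) / a \<le> 1" using y a by simp
  then have "coords I B a h i = 1" using i by (simp add: coords_def)
  moreover have "supp (coords I B a h) \<in> nerve Y I B (4 * a)"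
  proof (rule nerve_by_height[OF G h])
    show "supp (coords I B a h) \<subseteq> I" using supp_coords(1)[OF G a] by blast
    show "\<exists>z\<in>B i. h z \<le> 2 * a" if "i \<in> supp (coords I B a h)" for i
      using supp_coords(2)[OF G a that] less_imp_le by blast
  qed
  moreover have "0 \<le> coords I B a h j \<and> coords I B a h j \<le> 1" for j by (simp add: coords_def)
  ultimately show ?thesis unfolding realization_def by blast
qed

text \<open>Replacing the representatives of a simplex by the base points \<open>y i\<close> costs twice the diameter bound
  \<open>4 * c * a\<close>. The next scale \<open>a'\<close> is large enough to absorb this, so \<open>p\<close> is simplicial.\<close>

lemma nerve_refinement:
  assumes G: "good_cover Y n c (4 * a) I B" and G': "good_cover Y n c (4 * a') I' B'"
    and aa': "(1 + 2 * c) * a \<le> a'"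
    and yp: "\<And>i. i \<in> I \<Longrightarrow> y i \<in> B i \<and> p i \<in> I' \<and> y i \<in> B' (p i)"
    and S: "S \<in> nerve Y I B (4 * a)"
  shows "p ` S \<in> nerve Y I' B' (4 * a')"
proof -
  obtain z where z': "\<forall>i\<in>S. z i \<in> B i" "\<forall>i\<in>S. \<forall>j\<in>S. mdist Y (z i) (z j) \<le> 4 * a"
    and SI: "S \<subseteq> I" using S unfolding nerve_def by blast
  then have z: "\<And>i. i \<in> S \<Longrightarrow> z i \<in> B i" "\<And>i j. i \<in> S \<Longrightarrow> j \<in> S \<Longrightarrow> mdist Y (z i) (z j) \<le> 4 * a"
    by blast+
  define q where "q = (\<lambda>k. SOME i. i \<in> S \<and> p i = k)"
  have q: "q k \<in> S \<and> p (q k) = k" if "k \<in> p ` S" for k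
    using someI_ex[of "\<lambda>i. i \<in> S \<and> p i = k"] that by (auto simp: q_def)
  have dist: "mdist Y (y i) (y j) \<le> 4 * a'" if "i \<in> S" "j \<in> S" for i j
  proof -
    have ij: "i \<in> I" "j \<in> I" using that SI by auto
    have mem: "y i \<in> mspace Y" "y j \<in> mspace Y" "z i \<in> mspace Y" "z j \<in> mspace Y"
      using G yp ij z(1) that by (auto simp: good_cover_def)
    have "mdist Y (y i) (y j) \<le> mdist Y (y i) (z i) + (mdist Y (z i) (z j) + mdist Y (z j) (y j))"
      using mdist_triangle[of "y i" Y "z i" "y j"] mdist_triangle[of "z i" Y "z j" "y j"] mem by linarith
    also have "\<dots> \<le> c * (4 * a) + (4 * a + c * (4 * a))"
      using G yp ij z that by (intro add_mono) (auto simp: good_cover_def)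
    also have "\<dots> = 4 * ((1 + 2 * c) * a)" by (simp add: algebra_simps)
    finally show ?thesis using aa' by linarith
  qed
  have "\<forall>k\<in>p ` S. y (q k) \<in> B' k" "p ` S \<subseteq> I'"
    using q yp SI by (metis subsetD) (use yp SI in auto)
  then show ?thesis
    unfolding nerve_def using q dist by (intro CollectI conjI exI[of _ "\<lambda>k. y (q k)"]) auto
qed

text \<open>The base points \<open>y i\<close> of the small members near \<open>h\<close> are within \<open>2 * a'\<close> of \<open>h\<close>. They represent the members \<open>p i\<close> of the
  coarse cover, which therefore span a simplex together with the coarse members near \<open>h\<close>.\<close>

lemma coords_compatible:
  assumes G: "good_cover Y n c (4 * a) I B" and G': "good_cover Y n c (4 * a') I' B'"
    and a: "0 < a" "0 \<le> c" and aa': "(1 + 2 * c) * a \<le> a'"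
    and yp: "\<And>i. i \<in> I \<Longrightarrow> y i \<in> B i \<and> p i \<in> I' \<and> y i \<in> B' (p i)"
    and h: "katetov Y h" and Y: "mspace Y \<noteq> {}" and low: "height Y h < a"
  shows "compatible p (nerve Y I B (4 * a)) (nerve Y I' B' (4 * a')) (coords I B a h) (coords I' B' a' h)"
proof -
  have "0 \<le> 2 * c * a" using a by simp
  then have a': "a \<le> a'" using aa' by (simp add: algebra_simps)
  have "p ` supp (coords I B a h) \<union> supp (coords I' B' a' h) \<in> nerve Y I' B' (4 * a')"
  proof (rule nerve_by_height[OF G' h])
    show "p ` supp (coords I B a h) \<union> supp (coords I' B' a' h) \<subseteq> I'"
      using supp_coords(1)[OF G a(1)] supp_coords(1)[OF G'] a a' yp by (meson Un_least image_subsetI less_le_trans subsetI)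
    fix k assume "k \<in> p ` supp (coords I B a h) \<union> supp (coords I' B' a' h)"
    then consider i where "k = p i" "i \<in> supp (coords I B a h)" | "k \<in> supp (coords I' B' a' h)" by blast
    then show "\<exists>z\<in>B' k. h z \<le> 2 * a'"
    proof cases
      case 1
      have i: "i \<in> I" using supp_coords(1)[OF G a(1)] 1 by blast
      obtain z where z: "z \<in> B i" "h z < 2 * a" using supp_coords(2)[OF G a(1)] 1 by blast
      have "y i \<in> mspace Y" "z \<in> mspace Y" using yp[OF i] i z G by (auto simp: good_cover_def)
      then have "h (y i) \<le> h z + mdist Y (y i) z" using h by (auto simp: katetov_def)
      also have "\<dots> \<le> 2 * a + c * (4 * a)"
        using z yp[OF i] i G by (intro add_mono) (auto simp: good_cover_def)
      also have "\<dots> = 2 * ((1 + 2 * c) * a)" by (simp add: algebra_simps)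
      finally show ?thesis using yp[OF i] aa' 1(1) by (intro bexI[of _ "y i"]) auto
    next
      case 2
      then show ?thesis using supp_coords(2)[OF G', of a' k h] a a' by (auto intro: less_imp_le)
    qed
  qed
  then show ?thesis
    using coords_realization[OF G a(1) h Y low] coords_realization[OF G' _ h Y] a a' low
    by (auto simp: compatible_def)
qed

section \<open>The telescope over all scales\<close>

lemma cube_filling_mono:
  assumes "cube_filling TYPE('j) Y C m" "C \<le> C'"
  shows "cube_filling TYPE('j) Y C' m"
  unfolding cube_filling_def
proof (intro allI impI)
  fix u :: "'j \<Rightarrow> real" and L g
  assume L: "0 \<le> L" and *: "\<forall>j. 0 \<le> u j \<and> u j \<le> 1" "card (free_coords u) = Suc m"
    "lip_on Y L {v \<in> cube u. free_coords v \<noteq> free_coords u} g"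
  obtain g' where g': "lip_on Y (C * L) (cube u) g'"
      "\<forall>v\<in>cube u. free_coords v \<noteq> free_coords u \<longrightarrow> g' v = g v"
    using assms(1)[unfolded cube_filling_def, rule_format, OF L *(1)[rule_format] *(2,3)] by blast
  have "C * L \<le> C' * L" using assms(2) L by (rule mult_right_mono)
  then show "\<exists>g'. lip_on Y (C' * L) (cube u) g' \<and>
              (\<forall>v\<in>cube u. free_coords v \<noteq> free_coords u \<longrightarrow> g' v = g v)"
    using g' lip_on_mono[OF g'(1) subset_refl] by blast
qed

lemma uniform_cube_filling:
  assumes "\<forall>m\<le>n. Lipschitz_connected m Y"
  shows "\<exists>C\<ge>1. \<forall>m\<le>n. cube_filling TYPE('j) Y C m"
proof -
  have "\<forall>m. \<exists>C. m \<le> n \<longrightarrow> 1 \<le> C \<and> cube_filling TYPE('j) Y C m"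
    using assms Lipschitz_connected_imp_cube_filling by metis
  then obtain C where C: "\<And>m. m \<le> n \<Longrightarrow> 1 \<le> C m \<and> cube_filling TYPE('j) Y (C m) m"
    by metis
  have le: "C m \<le> (\<Sum>k\<le>n. C k)" if "m \<le> n" for m
    using C that by (intro member_le_sum) force+
  then have "1 \<le> (\<Sum>k\<le>n. C k)" using C[of 0] le[of 0] by linarith
  moreover have "cube_filling TYPE('j) Y (\<Sum>k\<le>n. C k) m" if "m \<le> n" for m
    using cube_filling_mono C le that by blast
  ultimately show ?thesis by blast
qed

text \<open>A realized vertex map stays close to the values at the vertices, since a simplex has diameter at most 1.\<close>

lemma near_vertex:
  assumes D: "complex_of_dim n D" and g: "\<And>u. u \<in> realization D \<Longrightarrow> lip_on Y L (cube u) g"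
    and u: "u \<in> realization D" and i: "i \<in> supp u"
  shows "mdist Y (g u) (g (indicator {i})) \<le> 2 * L"
proof -
  have S: "supp u \<in> D" using u by (simp add: realization_def)
  have si: "supp (indicator {i}) = {i}" by (auto simp: supp_def indicator_def)
  have "indicator {i} \<in> realization D"
    using complex_face[OF D S, of "{i}"] i
    unfolding realization_def by (auto simp: si indicator_def)
  moreover have "supp u \<union> supp (indicator {i}) \<in> D"
    using S i by (simp add: si insert_absorb)
  moreover have "\<bar>u j - indicator {i} j\<bar> \<le> 1" for j
  proof -
    have "0 \<le> u j" "u j \<le> 1" using u by (auto simp: realization_def)
    then show ?thesis by (auto simp: indicator_def abs_le_iff)
  qed
  ultimately show ?thesis
    using Lipschitz_on_simplex[OF D g u, of "indicator {i}" 1] by simp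
qed

text \<open>The base points of members that span a simplex are at distance at most \<open>4 * c * a + 4 * a + 4 * c * a\<close>;
  extension over the skeleta multiplies this bound by the factor \<open>(3 * C) ^ n\<close>.\<close>

lemma level_map_exists:
  fixes B :: "'i \<Rightarrow> 'y set"
  assumes C: "1 \<le> C" "\<And>m. m < n \<Longrightarrow> cube_filling TYPE('i) Y C m"
    and G: "good_cover Y n c (4 * a) I B" and a: "0 < a" "0 < c" and y: "\<And>i. i \<in> I \<Longrightarrow> y i \<in> B i"
  shows "\<exists>g. (\<forall>i\<in>I. g (indicator {i}) = y i) \<and>
     (\<forall>u\<in>realization (nerve Y I B (4 * a)). lip_on Y ((3 * C) ^ n * ((4 + 8 * c) * a)) (cube u) g)"
proof -
  let ?D = "nerve Y I B (4 * a)"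
  have mem: "x \<in> mspace Y" if "i \<in> I" "x \<in> B i" for i x
    using G that by (auto simp: good_cover_def)
  have "\<exists>g. (\<forall>i. {i} \<in> ?D \<longrightarrow> g (indicator {i}) = y i) \<and>
           (\<forall>u\<in>realization ?D. lip_on Y ((3 * C) ^ n * ((4 + 8 * c) * a)) (cube u) g)"
  proof (rule realize_vertex_map[OF C _ complex_nerve[OF G]])
    show "0 \<le> (4 + 8 * c) * a" using a by simp
    show "y i \<in> mspace Y" if "i \<in> \<Union>?D" for i
      using that y mem by (auto simp: nerve_def)
    show "mdist Y (y i) (y j) \<le> (4 + 8 * c) * a" if S: "S \<in> ?D" and ij: "i \<in> S" "j \<in> S" for S i j
    proof -
      obtain z where z: "\<forall>i\<in>S. z i \<in> B i" "\<forall>i\<in>S. \<forall>j\<in>S. mdist Y (z i) (z j) \<le> 4 * a"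
        and SI: "S \<subseteq> I" using S unfolding nerve_def by blast
      have I: "i \<in> I" "j \<in> I" using ij SI by auto
      then have m: "y i \<in> mspace Y" "y j \<in> mspace Y" "z i \<in> mspace Y" "z j \<in> mspace Y"
        using mem y z(1) ij by blast+
      have "mdist Y (y i) (y j) \<le> mdist Y (y i) (z i) + (mdist Y (z i) (z j) + mdist Y (z j) (y j))"
        using mdist_triangle[of "y i" Y "z i" "y j"] mdist_triangle[of "z i" Y "z j" "y j"] m by linarith
      also have "\<dots> \<le> c * (4 * a) + (4 * a + c * (4 * a))"
        using G y I z ij by (intro add_mono) (auto simp: good_cover_def)
      finally show ?thesis by (simp add: algebra_simps)
    qed
  qed
  then obtain g where g: "\<forall>i. {i} \<in> ?D \<longrightarrow> g (indicator {i}) = y i"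
    "\<forall>u\<in>realization ?D. lip_on Y ((3 * C) ^ n * ((4 + 8 * c) * a)) (cube u) g" by blast
  have "{i} \<in> ?D" if "i \<in> I" for i
  proof -
    have "mdist Y (y i) (y i) = 0" using mem[OF that y[OF that]] by simp
    then have "mdist Y (y i) (y i) \<le> 4 * a" using a by linarith
    then show ?thesis
      unfolding nerve_def using that y by (intro CollectI conjI exI[of _ y]) auto
  qed
  then show ?thesis using g by blast
qed

text \<open>The maps \<open>g\<close> and \<open>g' \<circ> push p\<close> are close: both stay near base points, and \<open>y i\<close> and \<open>y' (p i)\<close> lie in
  the same member \<open>B' (p i)\<close>.\<close>

lemma level_transition_exists:
  fixes B :: "'i \<Rightarrow> 'y set" and B' :: "'k \<Rightarrow> 'y set"
  assumes C: "1 \<le> C" "\<And>m. m \<le> n \<Longrightarrow> cube_filling TYPE('i option) Y C m"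
    and G: "good_cover Y n c (4 * a) I B" and G': "good_cover Y n c (4 * (r * a)) I' B'"
    and a: "0 < a" "0 < c" "1 + 2 * c \<le> r"
    and yp: "\<And>i. i \<in> I \<Longrightarrow> y i \<in> B i \<and> p i \<in> I' \<and> y i \<in> B' (p i)"
    and y': "\<And>k. k \<in> I' \<Longrightarrow> y' k \<in> B' k"
    and g: "\<And>i. i \<in> I \<Longrightarrow> g (indicator {i}) = y i"
      "\<And>u. u \<in> realization (nerve Y I B (4 * a)) \<Longrightarrow> lip_on Y (E * a) (cube u) g"
    and g': "\<And>k. k \<in> I' \<Longrightarrow> g' (indicator {k}) = y' k"
      "\<And>u. u \<in> realization (nerve Y I' B' (4 * (r * a))) \<Longrightarrow> lip_on Y (E * (r * a)) (cube u) g'"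
    and E: "0 \<le> E"
  shows "\<exists>T. transition Y (16 * (3 * C) ^ Suc n * ((E * (1 + r) + 2 * c * r) * a)) p
           (nerve Y I B (4 * a)) (nerve Y I' B' (4 * (r * a))) g g' T"
proof -
  let ?D = "nerve Y I B (4 * a)" and ?D' = "nerve Y I' B' (4 * (r * a))"
  let ?L = "(E * (1 + r) + 2 * c * r) * a"
  have D: "complex_of_dim n ?D" and D': "complex_of_dim n ?D'" using complex_nerve G G' by blast+
  have r: "0 \<le> r" using a by linarith
  have nn: "0 \<le> E * a" "0 \<le> E * r * a" "0 \<le> c * r * a" using a r E by auto
  then have L: "0 \<le> ?L" "E * a \<le> ?L" "E * (r * a) \<le> ?L" by (auto simp: algebra_simps)
  have p: "p ` S \<in> ?D'" if "S \<in> ?D" for S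
    using nerve_refinement[OF G G' _ yp that] a mult_right_mono[OF a(3), of a] by simp
  show ?thesis
  proof (rule transition_exists[OF C L(1) D D' p])
    show "lip_on Y ?L (cube u) g" if "u \<in> realization ?D" for u
      using lip_on_mono[OF g(2)[OF that] subset_refl L(2)] .
    show "lip_on Y ?L (cube u) g'" if "u \<in> realization ?D'" for u
      using lip_on_mono[OF g'(2)[OF that] subset_refl L(3)] .
    show "mdist Y (g u) (g' (push p u)) \<le> 2 * ?L" if u: "u \<in> realization ?D" for u
    proof -
      have rng: "\<And>i. 0 \<le> u i \<and> u i \<le> 1" using u by (auto simp: realization_def)
      obtain i where i: "u i = 1" using u by (auto simp: realization_def)
      then have "i \<in> supp u" by (simp add: supp_def)
      moreover from this have I: "i \<in> I" using u by (auto simp: realization_def nerve_def)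
      ultimately have 1: "mdist Y (g u) (y i) \<le> 2 * (E * a)"
        using near_vertex[OF D g(2) u, of i] g(1) by simp
      have u': "push p u \<in> realization ?D'" by (rule push_realization[OF D' p u])
      have "1 \<le> push p u (p i)" using push_ge[of u i p] rng i by simp
      then have "p i \<in> supp (push p u)" by (auto simp: supp_def)
      then have 2: "mdist Y (g' (push p u)) (y' (p i)) \<le> 2 * (E * (r * a))"
        using near_vertex[OF D' g'(2) u', of "p i"] g'(1) yp[OF I] by simp
      have 3: "mdist Y (y i) (y' (p i)) \<le> c * (4 * (r * a))"
        using G' yp[OF I] y'[of "p i"] by (auto simp: good_cover_def)
      have m: "g u \<in> mspace Y" "g' (push p u) \<in> mspace Y"
        using lip_on_mem[OF g(2)[OF u]] lip_on_mem[OF g'(2)[OF u']]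
          cubical_self[OF cubical_realization[OF D] u] cubical_self[OF cubical_realization[OF D'] u'] by blast+
      have m': "y i \<in> mspace Y" "y' (p i) \<in> mspace Y"
        using yp[OF I] y'[of "p i"] I G G' by (auto simp: good_cover_def)
      have "mdist Y (g u) (g' (push p u)) \<le>
          mdist Y (g u) (y i) + (mdist Y (y i) (y' (p i)) + mdist Y (g' (push p u)) (y' (p i)))"
        using mdist_triangle[of "g u" Y "y i" "g' (push p u)"]
          mdist_triangle[of "y i" Y "y' (p i)" "g' (push p u)"] m m'
          mdist_commute[of Y "g' (push p u)" "y' (p i)"] by linarith
      also have "\<dots> \<le> 2 * (E * a) + (c * (4 * (r * a)) + 2 * (E * (r * a)))"
        using 1 2 3 by linarith
      finally show ?thesis by (simp add: algebra_simps)
    qed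
  qed auto
qed

lemma clamp_close:
  fixes x x' e :: real
  assumes "\<bar>x - x'\<bar> \<le> e"
  shows "\<bar>3 * max 0 (min 1 (8 * x - 1)) - 3 * max 0 (min 1 (8 * x' - 1))\<bar> \<le> 24 * e"
  using assms by (simp add: max_def min_def abs_if split: if_splits)

text \<open>The maps \<open>F k\<close> are pieces of the desired map, one for each scale \<open>r powr k\<close>. The piece \<open>F k\<close> is defined for all
  \<open>h\<close> of height below the scale; as the height grows from \<open>1/8\<close> to \<open>1/4\<close> of the scale, it runs through the
  transition from the map of the \<open>k\<close>-th nerve to that of the next one. Above half the scale it has therefore
  arrived at the second map, while \<open>F (k + 1)\<close> has not yet left it because \<open>r \<ge> 8\<close>: consecutive pieces
  agree on an overlap. All estimates scale with \<open>r powr k\<close>.\<close>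

lemma telescope_maps:
  fixes Y :: "'y metric"
  assumes ne: "mspace Y \<noteq> {}" and nagata: "nagata_dim Y \<le> ereal (real n)"
    and conn: "\<forall>m\<le>n. Lipschitz_connected m Y"
  shows "\<exists>r A N. \<exists>F :: int \<Rightarrow> ('y \<Rightarrow> real) \<Rightarrow> 'y. 8 \<le> r \<and> 0 \<le> A \<and> 0 \<le> N \<and>
    (\<forall>k h. katetov Y h \<and> height Y h < r powr k \<longrightarrow>
       F k h \<in> mspace Y \<and>
       (\<forall>y\<in>mspace Y. mdist Y (F k h) y \<le> N * r powr k + h y) \<and>
       (r powr k / 2 \<le> height Y h \<longrightarrow> F k h = F (k + 1) h) \<and>
       (\<forall>h' \<delta>. katetov Y h' \<and> height Y h' < r powr k \<and> \<delta> < r powr k \<and>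
          (\<forall>y\<in>mspace Y. \<bar>h y - h' y\<bar> \<le> \<delta>) \<longrightarrow> mdist Y (F k h) (F k h') \<le> A * \<delta>))"
proof -
  obtain C1 where C1: "1 \<le> C1" "\<And>m. m \<le> n \<Longrightarrow> cube_filling TYPE('y set) Y C1 m"
    using uniform_cube_filling[OF conn] by metis
  obtain C2 where C2: "1 \<le> C2" "\<And>m. m \<le> n \<Longrightarrow> cube_filling TYPE('y set option) Y C2 m"
    using uniform_cube_filling[OF conn] by metis
  obtain c where c: "0 < c" and "\<forall>s>0. \<exists>(I :: 'y set set) B. good_cover Y n c s I B"
    using nagata_dim_imp_good_covers[OF nagata] by blast
  then obtain I0 B0 where IB0: "\<And>s. s > 0 \<Longrightarrow> good_cover Y n c s (I0 s :: 'y set set) (B0 s)"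
    by metis
  define r where "r = 8 + 2 * c"
  have r: "8 \<le> r" "1 + 2 * c \<le> r" using c by (auto simp: r_def)
  define a where "a = (\<lambda>k :: int. r powr k)"
  have a0: "0 < a k" for k using r by (simp add: a_def)
  have aS: "a (k + 1) = r * a k" for k using r by (simp add: a_def powr_add)
  have aS8: "8 * a k \<le> a (k + 1)" for k using aS[of k] r a0[of k] by simp
  define I where "I = (\<lambda>k. I0 (4 * a k))"
  define B where "B = (\<lambda>k. B0 (4 * a k))"
  define D where "D = (\<lambda>k. nerve Y (I k) (B k) (4 * a k))"
  have G: "good_cover Y n c (4 * a k) (I k) (B k)" for k
    using IB0[of "4 * a k"] a0[of k] by (simp add: I_def B_def)
  have D: "complex_of_dim n (D k)" for k unfolding D_def by (rule complex_nerve[OF G])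
  define y where "y = (\<lambda>k i. SOME y. y \<in> B k i)"
  have y: "y k i \<in> B k i" if "i \<in> I k" for k i
    using G[of k] that by (auto simp: y_def good_cover_def some_in_eq)
  have "\<forall>k i. \<exists>j. i \<in> I k \<longrightarrow> j \<in> I (k + 1) \<and> y k i \<in> B (k + 1) j"
  proof (intro allI)
    fix k i
    show "\<exists>j. i \<in> I k \<longrightarrow> j \<in> I (k + 1) \<and> y k i \<in> B (k + 1) j"
    proof (cases "i \<in> I k")
      case True
      then have "y k i \<in> mspace Y" using y[OF True] G[of k] by (auto simp: good_cover_def)
      then have "y k i \<in> (\<Union>j\<in>I (k + 1). B (k + 1) j)" using G[of "k + 1"] by (simp add: good_cover_def)
      then show ?thesis by blast
    qed simp
  qed
  then obtain p where p: "\<And>k i. i \<in> I k \<Longrightarrow> p k i \<in> I (k + 1) \<and> y k i \<in> B (k + 1) (p k i)"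
    by metis
  define E where "E = (3 * C1) ^ n * (4 + 8 * c)"
  have E: "0 \<le> E" using C1(1) c by (simp add: E_def)
  have "\<exists>g. (\<forall>i\<in>I k. g (indicator {i}) = y k i) \<and> (\<forall>u\<in>realization (D k). lip_on Y (E * a k) (cube u) g)" for k
    using level_map_exists[OF C1(1) _ G a0 c y, of k] C1(2) by (simp add: D_def E_def mult.assoc)
  then obtain g where g: "\<And>k i. i \<in> I k \<Longrightarrow> g k (indicator {i}) = y k i"
    "\<And>k u. u \<in> realization (D k) \<Longrightarrow> lip_on Y (E * a k) (cube u) (g k)" by metis
  define A where "A = 16 * (3 * C2) ^ Suc n * (E * (1 + r) + 2 * c * r)"
  have A: "0 \<le> A" using C2(1) E c r by (simp add: A_def)
  have "\<exists>T. transition Y (A * a k) (p k) (D k) (D (k + 1)) (g k) (g (k + 1)) T" for k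
  proof -
    have G': "good_cover Y n c (4 * (r * a k)) (I (k + 1)) (B (k + 1))" using G[of "k + 1"] by (simp add: aS)
    have g2: "lip_on Y (E * (r * a k)) (cube u) (g (k + 1))"
      if "u \<in> realization (nerve Y (I (k + 1)) (B (k + 1)) (4 * (r * a k)))" for u
      using g(2)[of u "k + 1"] that by (simp add: D_def aS)
    have g1: "lip_on Y (E * a k) (cube u) (g k)" if "u \<in> realization (nerve Y (I k) (B k) (4 * a k))" for u
      using g(2) that by (simp add: D_def)
    show ?thesis
      using level_transition_exists[OF C2 G G' a0 c r(2), of "y k" "p k" "y (k + 1)" "g k" E "g (k + 1)"]
        y p g(1) g1 g2 E by (simp add: D_def A_def aS mult.assoc)
  qed
  then obtain T where T: "\<And>k. transition Y (A * a k) (p k) (D k) (D (k + 1)) (g k) (g (k + 1)) (T k)"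
    by metis
  define u where "u = (\<lambda>k. coords (I k) (B k) (a k))"
  define \<tau> where "\<tau> = (\<lambda>k h. 3 * max 0 (min 1 (8 * height Y h / a k - 1)))"
  define F where "F = (\<lambda>k h. T k (u k h) (u (k + 1) h) (\<tau> k h))"
  have \<tau>: "\<tau> k h \<in> {0..3}" for k h by (auto simp: \<tau>_def)
  have comp: "compatible (p k) (D k) (D (k + 1)) (u k h) (u (k + 1) h)"
    if "katetov Y h" "height Y h < a k" for k h
    unfolding D_def u_def
    using that y p c r(2) a0[of k] ne
    by (intro coords_compatible[OF G G, where y = "y k"]) (auto simp: aS mult_right_mono)
  note tr = T[unfolded transition_def, rule_format]
  show ?thesis
  proof (intro exI conjI allI impI; (elim conjE)?)
    show "8 \<le> r" by (rule r)
    show "0 \<le> 25 * A" using A by simp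
    show "0 \<le> 3 * A + 2 * E + 4 * c + 2" using A E c by simp
    fix k :: int and h assume h: "katetov Y h" and "height Y h < r powr k"
    then have low: "height Y h < a k" by (simp add: a_def)
    note c1 = comp[OF h low]
    show FY: "F k h \<in> mspace Y"
      unfolding F_def using tr[OF c1] \<tau> by blast
    show "\<forall>x\<in>mspace Y. mdist Y (F k h) x \<le> (3 * A + 2 * E + 4 * c + 2) * r powr k + h x"
    proof
      fix x assume x: "x \<in> mspace Y"
      have uD: "u k h \<in> realization (D k)" using c1 by (simp add: compatible_def)
      then obtain i where i: "i \<in> supp (u k h)" by (force simp: realization_def supp_def)
      then have iI: "i \<in> I k" and "\<exists>z\<in>B k i. h z < 2 * a k"
        using supp_coords[OF G a0] by (auto simp: u_def)
      then obtain z where z: "z \<in> B k i" "h z < 2 * a k" by blast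
      have m: "y k i \<in> mspace Y" "z \<in> mspace Y" using y[OF iI] z iI G[of k] by (auto simp: good_cover_def)
      have t0: "T k (u k h) (u (k + 1) h) 0 = g k (u k h)" using tr[OF c1] by blast
      have "mdist Y (T k (u k h) (u (k + 1) h) (\<tau> k h)) (T k (u k h) (u (k + 1) h) 0) \<le> A * a k * \<bar>\<tau> k h - 0\<bar>"
        using tr[OF c1] \<tau>[of k h] by (meson atLeastAtMost_iff order_refl zero_le_numeral)
      also have "\<dots> \<le> A * a k * 3" using A a0[of k] \<tau>[of k h] by (intro mult_left_mono) auto
      finally have 1: "mdist Y (F k h) (g k (u k h)) \<le> 3 * A * a k" by (simp add: F_def t0)
      have 2: "mdist Y (g k (u k h)) (y k i) \<le> 2 * (E * a k)"
        using near_vertex[OF D[of k] g(2)[of _ k] uD i] g(1)[OF iI] by simp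
      have 3: "mdist Y (y k i) z \<le> c * (4 * a k)" using G[of k] y[OF iI] z iI by (auto simp: good_cover_def)
      have 4: "mdist Y z x \<le> h z + h x" using h m x by (auto simp: katetov_def)
      have gm: "g k (u k h) \<in> mspace Y" using tr[OF c1, THEN conjunct1] t0 tr[OF c1] by (metis atLeastAtMost_iff order_refl zero_le_numeral)
      have "mdist Y (F k h) x \<le> mdist Y (F k h) (g k (u k h)) + (mdist Y (g k (u k h)) (y k i) +
          (mdist Y (y k i) z + mdist Y z x))"
        using mdist_triangle[of "F k h" Y "g k (u k h)" x] mdist_triangle[of "g k (u k h)" Y "y k i" x]
          mdist_triangle[of "y k i" Y z x] FY gm m x by linarith
      also have "\<dots> \<le> 3 * A * a k + (2 * (E * a k) + (c * (4 * a k) + (2 * a k + h x)))"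
        using 1 2 3 4 z by linarith
      finally show "mdist Y (F k h) x \<le> (3 * A + 2 * E + 4 * c + 2) * r powr k + h x"
        by (simp add: a_def algebra_simps)
    qed
    show "F k h = F (k + 1) h" if "r powr k / 2 \<le> height Y h"
    proof -
      have "1 / 2 \<le> height Y h / a k" using that a0[of k] by (simp add: a_def field_simps)
      then have t3: "\<tau> k h = 3" by (simp add: \<tau>_def)
      have "8 * height Y h \<le> a (k + 1)" using low aS8[of k] by linarith
      then have "8 * height Y h / a (k + 1) \<le> 1" using a0[of "k + 1"] by simp
      then have t0: "\<tau> (k + 1) h = 0" by (simp add: \<tau>_def)
      have "height Y h < a (k + 1)" using low aS8[of k] a0[of k] by linarith
      then have c2: "compatible (p (k + 1)) (D (k + 1)) (D (k + 1 + 1)) (u (k + 1) h) (u (k + 1 + 1) h)"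
        using comp[OF h] by blast
      have "F k h = g (k + 1) (u (k + 1) h)" using tr[OF c1] by (simp add: F_def t3)
      moreover have "F (k + 1) h = g (k + 1) (u (k + 1) h)" using tr[OF c2] by (simp add: F_def t0)
      ultimately show ?thesis by simp
    qed
    fix h' \<delta> assume h': "katetov Y h'" and "height Y h' < r powr k" "\<delta> < r powr k"
      and d: "\<forall>y\<in>mspace Y. \<bar>h y - h' y\<bar> \<le> \<delta>"
    then have low': "height Y h' < a k" and \<delta>: "\<delta> < a k" by (auto simp: a_def)
    obtain y0 where "y0 \<in> mspace Y" using ne by blast
    then have \<delta>0: "0 \<le> \<delta>" using d abs_ge_zero order_trans by blast
    note c2 = comp[OF h' low']
    let ?e = "\<delta> / a k"
    have e: "?e < 1" "0 \<le> ?e" using \<delta> \<delta>0 a0[of k] by auto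
    have "\<bar>u k h i - u k h' i\<bar> \<le> ?e" for i
      unfolding u_def using coords_close[OF G a0 h h' _ \<delta>0] d by blast
    moreover have "\<bar>u (k + 1) h i - u (k + 1) h' i\<bar> \<le> ?e" for i
    proof -
      have "\<bar>u (k + 1) h i - u (k + 1) h' i\<bar> \<le> \<delta> / a (k + 1)"
        unfolding u_def using coords_close[OF G a0 h h' _ \<delta>0] d by blast
      also have "\<dots> \<le> ?e" using \<delta>0 a0[of k] aS8[of k] by (intro divide_left_mono) auto
      finally show ?thesis .
    qed
    ultimately have 1: "mdist Y (T k (u k h) (u (k + 1) h) (\<tau> k h')) (F k h') \<le> A * a k * ?e"
      unfolding F_def using tr[OF c1] c2 e(1) \<tau>[of k h'] by blast
    have "\<bar>height Y h - height Y h'\<bar> \<le> \<delta>" using height_close[OF h h' ne] d by blast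
    then have "\<bar>height Y h - height Y h'\<bar> / a k \<le> ?e" using a0[of k] by (simp add: divide_right_mono)
    then have "\<bar>height Y h / a k - height Y h' / a k\<bar> \<le> ?e"
      using a0[of k] by (simp add: diff_divide_distrib[symmetric])
    then have "\<bar>\<tau> k h - \<tau> k h'\<bar> \<le> 24 * ?e" 
      unfolding \<tau>_def times_divide_eq_right[symmetric] by (rule clamp_close)
    then have "A * a k * \<bar>\<tau> k h - \<tau> k h'\<bar> \<le> A * a k * (24 * ?e)"
      using A a0[of k] by (intro mult_left_mono) auto
    moreover have "mdist Y (F k h) (T k (u k h) (u (k + 1) h) (\<tau> k h')) \<le> A * a k * \<bar>\<tau> k h - \<tau> k h'\<bar>"
      unfolding F_def using tr[OF c1] \<tau> by blast
    ultimately have 2: "mdist Y (F k h) (T k (u k h) (u (k + 1) h) (\<tau> k h')) \<le> A * a k * (24 * ?e)"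
      by linarith
    have m: "T k (u k h) (u (k + 1) h) (\<tau> k h') \<in> mspace Y" "F k h' \<in> mspace Y"
      using tr[OF c1] tr[OF c2] \<tau> unfolding F_def by blast+
    have "mdist Y (F k h) (F k h') \<le> A * a k * (24 * ?e) + A * a k * ?e"
      using mdist_triangle[OF FY m] 1 2 by linarith
    also have "\<dots> = 25 * A * \<delta>" using a0[of k] by (simp add: field_simps)
    finally show "mdist Y (F k h) (F k h') \<le> 25 * A * \<delta>" .
  qed
qed

section \<open>A Lipschitz map from Katetov functions to the space\<close>

text \<open>A minimizing sequence is Cauchy since \<open>d (y, z) \<le> h y + h z\<close>.\<close>

lemma height_zero_attained:
  assumes Y: "mcomplete_of Y" "mspace Y \<noteq> {}" and h: "katetov Y h" and zero: "height Y h = 0"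
  shows "\<exists>y\<in>mspace Y. h y = 0"
proof -
  interpret M: Metric_space "mspace Y" "mdist Y" by (rule Metric_space_mspace_mdist)
  have "\<exists>y\<in>mspace Y. h y < 1 / real (Suc m)" for m
    using Inf_image_less[OF Y(2), of h "1 / real (Suc m)"] zero by (simp add: height_def)
  then obtain \<sigma> where \<sigma>: "\<And>m. \<sigma> m \<in> mspace Y" "\<And>m. h (\<sigma> m) < 1 / real (Suc m)" by metis
  have small: "\<exists>N. \<forall>m\<ge>N. h (\<sigma> m) < \<epsilon>" if \<epsilon>: "0 < \<epsilon>" for \<epsilon>
  proof -
    obtain N where N: "1 / real (Suc N) < \<epsilon>" using nat_approx_posE[OF \<epsilon>] by (auto simp: inverse_eq_divide)
    have "h (\<sigma> m) < \<epsilon>" if "N \<le> m" for m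
    proof -
      have "1 / real (Suc m) \<le> 1 / real (Suc N)" using that by (intro divide_left_mono) auto
      then show ?thesis using \<sigma>(2)[of m] N by linarith
    qed
    then show ?thesis by blast
  qed
  have "M.MCauchy \<sigma>"
    unfolding M.MCauchy_def
  proof (intro conjI allI impI)
    show "range \<sigma> \<subseteq> mspace Y" using \<sigma>(1) by blast
    fix \<epsilon> :: real assume "0 < \<epsilon>"
    then obtain N where N: "\<And>m. N \<le> m \<Longrightarrow> h (\<sigma> m) < \<epsilon> / 2" using small[of "\<epsilon> / 2"] by auto
    have "mdist Y (\<sigma> m) (\<sigma> m') < \<epsilon>" if "N \<le> m" "N \<le> m'" for m m'
    proof -
      have "mdist Y (\<sigma> m) (\<sigma> m') \<le> h (\<sigma> m) + h (\<sigma> m')" using h \<sigma>(1) by (simp add: katetov_def)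
      then show ?thesis using N[OF that(1)] N[OF that(2)] by linarith
    qed
    then show "\<exists>N. \<forall>n n'. N \<le> n \<longrightarrow> N \<le> n' \<longrightarrow> mdist Y (\<sigma> n) (\<sigma> n') < \<epsilon>" by blast
  qed
  then obtain y where "limitin M.mtopology \<sigma> y sequentially"
    using Y(1) by (auto simp: mcomplete_of_def M.mcomplete_def)
  then have y: "y \<in> mspace Y" and lim: "\<And>\<epsilon>. 0 < \<epsilon> \<Longrightarrow> \<exists>N. \<forall>m\<ge>N. mdist Y (\<sigma> m) y < \<epsilon>"
    unfolding M.limit_metric_sequentially by blast+
  have "h y \<le> 0 + \<epsilon>" if \<epsilon>: "0 < \<epsilon>" for \<epsilon>
  proof -
    obtain N where N: "\<And>m. N \<le> m \<Longrightarrow> h (\<sigma> m) < \<epsilon> / 2" using small[of "\<epsilon> / 2"] \<epsilon> by auto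
    obtain N' where N': "\<And>m. N' \<le> m \<Longrightarrow> mdist Y (\<sigma> m) y < \<epsilon> / 2" using lim[of "\<epsilon> / 2"] \<epsilon> by auto
    have "h y \<le> h (\<sigma> (max N N')) + mdist Y y (\<sigma> (max N N'))"
      using h y \<sigma>(1) by (simp add: katetov_def)
    then show ?thesis
      using N[of "max N N'"] N'[of "max N N'"] mdist_commute[of Y y "\<sigma> (max N N')"] by simp
  qed
  then have "h y \<le> 0" by (rule field_le_epsilon)
  then show ?thesis using katetov_nonneg[OF h y] y by (intro bexI[of _ y]) auto
qed

text \<open>If the change \<open>\<delta>\<close> is smaller than the height of the lower function, then both functions fall under one of the pieces of the
  telescope, by the overlap. Otherwise the route through a nearly closest point \<open>y\<close> of \<open>Y\<close> is short enough, since
  \<open>\<phi> h\<close> is never further from \<open>y\<close> than a multiple of the height of \<open>h\<close> plus \<open>h y\<close>. The second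
  estimate also covers height 0, where \<open>\<phi> h\<close> is the point at which \<open>h\<close> vanishes.\<close>

lemma Lipschitz_map_from_katetov:
  fixes Y :: "'y metric"
  assumes ne: "mspace Y \<noteq> {}" and complete: "mcomplete_of Y"
    and nagata: "nagata_dim Y \<le> ereal (real n)" and conn: "\<forall>m\<le>n. Lipschitz_connected m Y"
  shows "\<exists>\<phi> K. 0 \<le> K \<and>
    (\<forall>h. katetov Y h \<longrightarrow> \<phi> h \<in> mspace Y) \<and>
    (\<forall>h y. katetov Y h \<longrightarrow> y \<in> mspace Y \<longrightarrow> h y = 0 \<longrightarrow> \<phi> h = y) \<and>
    (\<forall>h h' \<delta>. katetov Y h \<longrightarrow> katetov Y h' \<longrightarrow> (\<forall>y\<in>mspace Y. \<bar>h y - h' y\<bar> \<le> \<delta>) \<longrightarrow>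
       mdist Y (\<phi> h) (\<phi> h') \<le> K * \<delta>)"
proof -
  obtain r A N and F :: "int \<Rightarrow> ('y \<Rightarrow> real) \<Rightarrow> 'y" where r: "8 \<le> r" and A: "0 \<le> A" and N: "0 \<le> N"
    and F: "\<forall>k h. katetov Y h \<and> height Y h < r powr k \<longrightarrow>
       F k h \<in> mspace Y \<and>
       (\<forall>y\<in>mspace Y. mdist Y (F k h) y \<le> N * r powr k + h y) \<and>
       (r powr k / 2 \<le> height Y h \<longrightarrow> F k h = F (k + 1) h) \<and>
       (\<forall>h' \<delta>. katetov Y h' \<and> height Y h' < r powr k \<and> \<delta> < r powr k \<and>
          (\<forall>y\<in>mspace Y. \<bar>h y - h' y\<bar> \<le> \<delta>) \<longrightarrow> mdist Y (F k h) (F k h') \<le> A * \<delta>)"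
    using telescope_maps[OF ne nagata conn] by metis
  \<comment> \<open>The scale \<open>r powr lev h\<close> is the smallest one that exceeds twice the height of \<open>h\<close>.\<close>
  define lev where "lev = (\<lambda>h. \<lfloor>log r (2 * height Y h)\<rfloor> + 1)"
  define \<phi> where "\<phi> = (\<lambda>h. if height Y h = 0 then SOME y. y \<in> mspace Y \<and> h y = 0 else F (lev h) h)"
  have powS: "r powr (k + 1) = r * r powr k" for k :: int
    using r by (simp add: powr_add)
  have lev: "r powr lev h \<le> 2 * r * height Y h" "2 * height Y h < r powr lev h"
    if "0 < height Y h" for h
  proof -
    have "r powr \<lfloor>log r (2 * height Y h)\<rfloor> \<le> 2 * height Y h"
      using that r by (subst le_log_iff[symmetric]) auto
    then show "r powr lev h \<le> 2 * r * height Y h"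
      using r powS[of "\<lfloor>log r (2 * height Y h)\<rfloor>"] mult_left_mono[of _ "2 * height Y h" r]
      by (simp add: lev_def mult.assoc mult.left_commute)
    show "2 * height Y h < r powr lev h"
      using that r by (subst log_less_iff[symmetric]) (auto simp: lev_def)
  qed
  have lev_unique: "lev h = k + 1" if "r powr k \<le> 2 * height Y h" "2 * height Y h < r powr (k + 1)" for h and k :: int
  proof -
    have "0 < r powr k" using r by simp
    then have pos: "0 < 2 * height Y h" using that by linarith
    have "k \<le> log r (2 * height Y h)" using that r pos by (subst le_log_iff) auto
    moreover have "log r (2 * height Y h) < k + 1" using that r pos by (subst log_less_iff) auto
    ultimately show ?thesis by (simp add: lev_def floor_unique)
  qed
  have zero: "\<phi> h \<in> mspace Y \<and> h (\<phi> h) = 0" if "katetov Y h" "height Y h = 0" for h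
    using someI_ex[of "\<lambda>y. y \<in> mspace Y \<and> h y = 0"] height_zero_attained[OF complete ne that] that
    by (auto simp: \<phi>_def)
  have hpos: "0 < height Y h" if "katetov Y h" "height Y h \<noteq> 0" for h
    using height_nonneg[OF that(1) ne] that(2) by linarith
  have mem: "\<phi> h \<in> mspace Y" if h: "katetov Y h" for h
  proof (cases "height Y h = 0")
    case False
    then have "height Y h < r powr lev h" using lev(2)[OF hpos[OF h]] hpos[OF h] by simp
    then show ?thesis using F h False by (simp add: \<phi>_def)
  qed (use zero[OF h] in simp)
  have near: "mdist Y (\<phi> h) y \<le> 2 * N * r * height Y h + h y" if h: "katetov Y h" and y: "y \<in> mspace Y" for h y
  proof (cases "height Y h = 0")
    case True
    then show ?thesis using zero[OF h True] h y by (fastforce simp: katetov_def)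
  next
    case False
    note pos = hpos[OF h False]
    have "height Y h < r powr lev h" using lev(2)[OF pos] pos by simp
    then have "mdist Y (F (lev h) h) y \<le> N * r powr lev h + h y" using F h y by blast
    also have "\<dots> \<le> N * (2 * r * height Y h) + h y"
      using lev(1)[OF pos] N by (simp add: mult_left_mono)
    finally show ?thesis using False by (simp add: \<phi>_def ac_simps)
  qed
  \<comment> \<open>One piece of the telescope contributes \<open>A\<close>, the detour through a nearly closest point the other term.\<close>
  define K where "K = max A (6 * N * r + 3)"
  have K: "0 \<le> K" "A \<le> K" "6 * N * r + 3 \<le> K" using A by (auto simp: K_def)
  have Lip_ordered: "mdist Y (\<phi> h) (\<phi> h') \<le> K * \<delta>"
    if h: "katetov Y h" "katetov Y h'" and le: "height Y h \<le> height Y h'"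
      and d: "\<forall>y\<in>mspace Y. \<bar>h y - h' y\<bar> \<le> \<delta>" for h h' \<delta>
  proof -
    obtain y0 where "y0 \<in> mspace Y" using ne by blast
    then have \<delta>: "0 \<le> \<delta>" using d abs_ge_zero order_trans by blast
    have hd: "height Y h' \<le> height Y h + \<delta>" using height_close[OF h ne] d by fastforce
    show ?thesis
    proof (cases "\<delta> < height Y h")
      case True
      then have pos: "0 < height Y h" "0 < height Y h'" using \<delta> le by auto
      let ?k = "lev h"
      have k: "2 * height Y h < r powr ?k" "height Y h < r powr ?k" "height Y h' < r powr ?k" "\<delta> < r powr ?k"
        using lev(2)[OF pos(1)] pos hd True by auto
      have "\<phi> h' = F ?k h'"
      proof (cases "2 * height Y h' < r powr ?k")
        case True
        have e: "r powr ?k = r * r powr (?k - 1)" using powS[of "?k - 1"] by simp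
        have "r * r powr (?k - 1) \<le> r * (2 * height Y h)"
          using lev(1)[OF pos(1)] unfolding e by (simp add: mult.commute mult.left_commute)
        then have "r powr (?k - 1) \<le> 2 * height Y h" using r by simp
        then have "lev h' = (?k - 1) + 1" using True le by (intro lev_unique) auto
        then show ?thesis using pos by (simp add: \<phi>_def)
      next
        case False
        have "2 * r powr ?k \<le> r * r powr ?k" using r by (intro mult_right_mono) auto
        then have "2 * height Y h' < r powr (?k + 1)" using k(3) powS[of ?k] by linarith
        then have "lev h' = ?k + 1" using False by (intro lev_unique) auto
        moreover have "F ?k h' = F (?k + 1) h'" using F h(2) k(3) False by auto
        ultimately show ?thesis using pos by (simp add: \<phi>_def)
      qed
      moreover have "\<phi> h = F ?k h" using pos by (simp add: \<phi>_def)
      ultimately have "mdist Y (\<phi> h) (\<phi> h') \<le> A * \<delta>" using F h k d by metis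
      also have "\<dots> \<le> K * \<delta>" using K \<delta> by (intro mult_right_mono) auto
      finally show ?thesis .
    next
      case False
      have "mdist Y (\<phi> h) (\<phi> h') \<le> K * \<delta> + \<epsilon>" if \<epsilon>: "0 < \<epsilon>" for \<epsilon>
      proof -
        obtain y where y: "y \<in> mspace Y" "h y < height Y h + \<epsilon> / 2"
          using Inf_image_less[OF ne, of h "height Y h + \<epsilon> / 2"] \<epsilon> by (auto simp: height_def)
        have yd: "h' y \<le> h y + \<delta>" using d y(1) by fastforce
        have NR: "0 \<le> 2 * N * r" using N r by simp
        have "mdist Y (\<phi> h) (\<phi> h') \<le> mdist Y (\<phi> h) y + mdist Y (\<phi> h') y"
          using mdist_triangle[OF mem[OF h(1)] y(1) mem[OF h(2)]] mdist_commute[of Y y] by simp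
        also have "\<dots> \<le> (2 * N * r * height Y h + h y) + (2 * N * r * height Y h' + h' y)"
          using near h y(1) by (intro add_mono) auto
        also have "\<dots> \<le> (2 * N * r * \<delta> + (\<delta> + \<epsilon> / 2)) + (2 * N * r * (2 * \<delta>) + (2 * \<delta> + \<epsilon> / 2))"
          using NR False hd y yd by (intro add_mono mult_left_mono) auto
        also have "\<dots> = (6 * N * r + 3) * \<delta> + \<epsilon>" by (simp add: algebra_simps)
        also have "\<dots> \<le> K * \<delta> + \<epsilon>" using K \<delta> by (simp add: mult_right_mono)
        finally show ?thesis .
      qed
      then show ?thesis by (rule field_le_epsilon)
    qed
  qed
  show ?thesis
  proof (intro exI[of _ \<phi>] exI[of _ K] conjI allI impI)
    show "0 \<le> K" by (rule K)
    show "\<phi> h \<in> mspace Y" if "katetov Y h" for h using mem[OF that] .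
    show "\<phi> h = y" if h: "katetov Y h" "y \<in> mspace Y" "h y = 0" for h y
    proof -
      have h0: "height Y h = 0"
        using height_le[OF h(1,2)] height_nonneg[OF h(1) ne] h(3) by simp
      then have "mdist Y (\<phi> h) y \<le> 0" using near[OF h(1,2)] h(3) by simp
      then have "mdist Y (\<phi> h) y = 0" using mdist_nonneg[of Y "\<phi> h" y] by linarith
      then show ?thesis using mem[OF h(1)] h(2) by simp
    qed
    show "mdist Y (\<phi> h) (\<phi> h') \<le> K * \<delta>"
      if h: "katetov Y h" "katetov Y h'" and d: "\<forall>y\<in>mspace Y. \<bar>h y - h' y\<bar> \<le> \<delta>" for h h' \<delta>
    proof (cases "height Y h \<le> height Y h'")
      case True
      then show ?thesis using Lip_ordered[OF h] d by blast
    next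
      case False
      then have "mdist Y (\<phi> h') (\<phi> h) \<le> K * \<delta>"
        using Lip_ordered[OF h(2,1)] d by (simp add: abs_minus_commute)
      then show ?thesis by (simp add: mdist_commute)
    qed
  qed
qed

section \<open>Extension of Lipschitz maps\<close>

text \<open>The largest distances that are allowed when a point at distance at most \<open>L * d (x, z)\<close> from \<open>f z\<close>, for every \<open>z \<in> Z\<close>, is
  added to \<open>Y\<close>. This is the McShane extension of the map \<open>f\<close> followed by the embedding
  of \<open>Y\<close> into its Katetov functions, evaluated at \<open>y\<close>.\<close>

lemma katetov_envelope:
  fixes X :: "'x metric" and Y :: "'y metric"
  assumes Z: "Z \<subseteq> mspace X" "Z \<noteq> {}" and L: "0 \<le> L" and f: "\<And>z. z \<in> Z \<Longrightarrow> f z \<in> mspace Y"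
    and fL: "\<And>z z'. z \<in> Z \<Longrightarrow> z' \<in> Z \<Longrightarrow> mdist Y (f z) (f z') \<le> L * mdist X z z'"
  defines "h \<equiv> \<lambda>x y. INF z\<in>Z. mdist Y (f z) y + L * mdist X x z"
  shows "\<And>x. x \<in> mspace X \<Longrightarrow> katetov Y (h x)"
    and "\<And>z. z \<in> Z \<Longrightarrow> h z (f z) = 0"
    and "\<And>x x' y. x \<in> mspace X \<Longrightarrow> x' \<in> mspace X \<Longrightarrow> \<bar>h x y - h x' y\<bar> \<le> L * mdist X x x'"
proof -
  have nn: "0 \<le> mdist Y (f z) y + L * mdist X x z" for x y z using L by simp
  have lower: "h x y \<le> mdist Y (f z) y + L * mdist X x z" if "z \<in> Z" for x y z
    unfolding h_def using that nn by (intro cINF_lower bdd_belowI[of _ 0]) auto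
  have greatest: "b \<le> h x y" if "\<And>z. z \<in> Z \<Longrightarrow> b \<le> mdist Y (f z) y + L * mdist X x z" for b x y
    unfolding h_def using Z(2) that by (rule cINF_greatest)
  show "katetov Y (h x)" if x: "x \<in> mspace X" for x
    unfolding katetov_def
  proof (intro ballI conjI)
    fix y y' assume y: "y \<in> mspace Y" "y' \<in> mspace Y"
    have "mdist Y y y' - h x y' \<le> h x y"
    proof (rule greatest)
      fix z assume z: "z \<in> Z"
      have "mdist Y y y' - (mdist Y (f z) y + L * mdist X x z) \<le> h x y'"
      proof (rule greatest)
        fix z' assume z': "z' \<in> Z"
        have zX: "z \<in> mspace X" "z' \<in> mspace X" using z z' Z by auto
        have "mdist X z z' \<le> mdist X x z + mdist X x z'"
          using mdist_triangle[OF zX(1) x zX(2)] by (simp add: mdist_commute)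
        then have "L * mdist X z z' \<le> L * mdist X x z + L * mdist X x z'"
          using L by (metis distrib_left mult_left_mono)
        then have "mdist Y (f z) (f z') \<le> L * mdist X x z + L * mdist X x z'"
          using fL[OF z z'] by linarith
        moreover have "mdist Y y y' \<le> mdist Y (f z) y + (mdist Y (f z) (f z') + mdist Y (f z') y')"
          using mdist_triangle[OF y(1) f[OF z] y(2)] mdist_triangle[OF f[OF z] f[OF z'] y(2)]
            mdist_commute[of Y y "f z"] by linarith
        ultimately show "mdist Y y y' - (mdist Y (f z) y + L * mdist X x z) \<le> mdist Y (f z') y' + L * mdist X x z'"
          by linarith
      qed
      then show "mdist Y y y' - h x y' \<le> mdist Y (f z) y + L * mdist X x z" by linarith
    qed
    then show "mdist Y y y' \<le> h x y + h x y'" by linarith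
    have "h x y - mdist Y y y' \<le> h x y'"
    proof (rule greatest)
      fix z assume z: "z \<in> Z"
      show "h x y - mdist Y y y' \<le> mdist Y (f z) y' + L * mdist X x z"
        using lower[OF z, of x y] mdist_triangle[OF f[OF z] y(2,1)] mdist_commute[of Y y y'] by linarith
    qed
    then show "h x y \<le> h x y' + mdist Y y y'" by linarith
  qed
  show "h z (f z) = 0" if z: "z \<in> Z" for z
  proof (rule antisym)
    have "mdist Y (f z) (f z) = 0" "mdist X z z = 0" using f[OF z] z Z(1) by auto
    then show "h z (f z) \<le> 0" using lower[OF z, of z "f z"] by (metis add_0 mult_zero_right)
    show "0 \<le> h z (f z)" using nn by (rule greatest)
  qed
  have one_sided: "h x y - L * mdist X x x' \<le> h x' y" if x: "x \<in> mspace X" "x' \<in> mspace X" for x x' y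
  proof (rule greatest)
    fix z assume z: "z \<in> Z"
    have "mdist X x z \<le> mdist X x x' + mdist X x' z" using x z Z by (intro mdist_triangle) auto
    then have "L * mdist X x z \<le> L * mdist X x x' + L * mdist X x' z"
      using L by (metis distrib_left mult_left_mono)
    then show "h x y - L * mdist X x x' \<le> mdist Y (f z) y + L * mdist X x' z"
      using lower[OF z, of x y] by linarith
  qed
  show "\<bar>h x y - h x' y\<bar> \<le> L * mdist X x x'" if "x \<in> mspace X" "x' \<in> mspace X" for x x' y
    using one_sided[OF that, of y] one_sided[OF that(2,1), of y] mdist_commute[of X x x'] by simp
qed

lemma Lipschitz_extension_from_katetov:
  fixes X :: "'x metric" and Y :: "'y metric"
  assumes ne: "mspace Y \<noteq> {}" and K: "0 \<le> K"
    and mem: "\<And>h. katetov Y h \<Longrightarrow> \<phi> h \<in> mspace Y"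
    and fix_pt: "\<And>h y. katetov Y h \<Longrightarrow> y \<in> mspace Y \<Longrightarrow> h y = 0 \<Longrightarrow> \<phi> h = y"
    and \<phi>_Lip: "\<And>h h' \<delta>. katetov Y h \<Longrightarrow> katetov Y h' \<Longrightarrow> (\<And>y. y \<in> mspace Y \<Longrightarrow> \<bar>h y - h' y\<bar> \<le> \<delta>) \<Longrightarrow>
       mdist Y (\<phi> h) (\<phi> h') \<le> K * \<delta>"
  shows "Lipschitz_extension_property X Y"
  unfolding Lipschitz_extension_property_def
proof (intro exI[of _ K] allI impI)
  fix Z and f :: "'x \<Rightarrow> 'y" assume Z: "Z \<subseteq> mspace X" and f: "Lipschitz_continuous_map (submetric X Z) Y f"
  define L where "L = Lip (submetric X Z) Y f"
  have sub: "mspace (submetric X Z) = Z" using Z by auto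
  have L: "0 \<le> L" unfolding L_def by (rule Lip_nonneg[OF f])
  have "\<exists>g. g \<in> mspace X \<rightarrow> mspace Y \<and> (\<forall>z\<in>Z. g z = f z) \<and>
          (\<forall>x\<in>mspace X. \<forall>x'\<in>mspace X. mdist Y (g x) (g x') \<le> K * L * mdist X x x')"
  proof (cases "Z = {}")
    case True
    obtain y0 where y0: "y0 \<in> mspace Y" using ne by blast
    then have "mdist Y y0 y0 = 0" by simp
    then have "mdist Y y0 y0 \<le> K * L * mdist X x x'" for x x' using K L by (metis mdist_nonneg mult_nonneg_nonneg)
    then show ?thesis using True y0 by (intro exI[of _ "\<lambda>_. y0"]) auto
  next
    case False
    have fm: "f z \<in> mspace Y" if "z \<in> Z" for z
      using Lipschitz_continuous_map_image[OF f] that sub by auto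
    have fL: "mdist Y (f z) (f z') \<le> L * mdist X z z'" if "z \<in> Z" "z' \<in> Z" for z z'
      using Lip_bound[OF f, unfolded sub] that by (simp add: L_def)
    define h where "h = (\<lambda>x y. INF z\<in>Z. mdist Y (f z) y + L * mdist X x z)"
    have env: "katetov Y (h x)" if "x \<in> mspace X" for x
      unfolding h_def by (rule katetov_envelope(1)[OF Z False L fm fL that])
    have env0: "h z (f z) = 0" if "z \<in> Z" for z
      unfolding h_def by (rule katetov_envelope(2)[OF Z False L fm fL that])
    have envL: "\<bar>h x y - h x' y\<bar> \<le> L * mdist X x x'" if "x \<in> mspace X" "x' \<in> mspace X" for x x' y
      unfolding h_def by (rule katetov_envelope(3)[OF Z False L fm fL that])
    show ?thesis
    proof (intro exI[of _ "\<lambda>x. \<phi> (h x)"] conjI ballI)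
      show "(\<lambda>x. \<phi> (h x)) \<in> mspace X \<rightarrow> mspace Y" using mem[OF env] by (rule Pi_I)
      show "\<phi> (h z) = f z" if "z \<in> Z" for z
        using fix_pt[OF env fm env0] that Z by blast
      show "mdist Y (\<phi> (h x)) (\<phi> (h x')) \<le> K * L * mdist X x x'" if "x \<in> mspace X" "x' \<in> mspace X" for x x'
        using \<phi>_Lip[OF env[OF that(1)] env[OF that(2)] envL[OF that]] by (simp add: mult.assoc)
    qed
  qed
  then obtain g where g: "g \<in> mspace X \<rightarrow> mspace Y" "\<forall>z\<in>Z. g z = f z"
    "\<forall>x\<in>mspace X. \<forall>x'\<in>mspace X. mdist Y (g x) (g x') \<le> K * L * mdist X x x'" by blast
  have "Lipschitz_continuous_map X Y g"
    unfolding Lipschitz_continuous_map_def using g by blast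
  moreover have "Lip X Y g \<le> K * L" using K L g(3) by (intro Lip_le) auto
  ultimately show "\<exists>g. Lipschitz_continuous_map X Y g \<and> (\<forall>z\<in>Z. g z = f z) \<and>
             Lip X Y g \<le> K * Lip (submetric X Z) Y f"
    using g(2) by (auto simp: L_def)
qed

text \<open>The inverse of an isometric embedding is a Lipschitz map defined on its image; an extension of it, followed by the embedding, is a retraction.\<close>

lemma Lipschitz_retract_if_extension_property:
  assumes "\<forall>X :: 'x metric. Lipschitz_extension_property X Y"
  shows "absolute_Lipschitz_retract TYPE('x) Y"
  unfolding absolute_Lipschitz_retract_def
proof (intro allI impI)
  fix X :: "'x metric" and e assume e: "isometric_embedding Y X e"
  let ?Z = "e ` mspace Y"
  have Z: "?Z \<subseteq> mspace X" and iso: "\<And>y y'. y \<in> mspace Y \<Longrightarrow> y' \<in> mspace Y \<Longrightarrow> mdist X (e y) (e y') = mdist Y y y'"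
    using e by (auto simp: isometric_embedding_def)
  define f where "f = inv_into (mspace Y) e"
  have f: "f z \<in> mspace Y" "e (f z) = z" if "z \<in> ?Z" for z
    using that by (auto simp: f_def inv_into_into f_inv_into_f)
  have fZ: "mdist Y (f z) (f z') \<le> 1 * mdist X z z'" if "z \<in> ?Z" "z' \<in> ?Z" for z z'
    using iso[OF f(1)[OF that(1)] f(1)[OF that(2)]] f(2)[OF that(1)] f(2)[OF that(2)] by simp
  have "Lipschitz_continuous_map (submetric X ?Z) Y f"
    unfolding Lipschitz_continuous_map_def
  proof (intro conjI exI[of _ 1] ballI)
    show "f \<in> mspace (submetric X ?Z) \<rightarrow> mspace Y" using f(1) by auto
    show "mdist Y (f z) (f z') \<le> 1 * mdist (submetric X ?Z) z z'"
      if "z \<in> mspace (submetric X ?Z)" "z' \<in> mspace (submetric X ?Z)" for z z'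
      using fZ[of z z'] that by auto
  qed
  then obtain g where g: "Lipschitz_continuous_map X Y g" "\<forall>z\<in>?Z. g z = f z"
    using assms Z unfolding Lipschitz_extension_property_def by blast
  obtain b where b: "\<forall>x\<in>mspace X. \<forall>x'\<in>mspace X. mdist Y (g x) (g x') \<le> b * mdist X x x'"
    and gm: "g \<in> mspace X \<rightarrow> mspace Y"
    using g(1) unfolding Lipschitz_continuous_map_def by blast
  have "Lipschitz_continuous_map X (submetric X ?Z) (e \<circ> g)"
    unfolding Lipschitz_continuous_map_def
  proof (intro conjI exI[of _ b] ballI)
    show "e \<circ> g \<in> mspace X \<rightarrow> mspace (submetric X ?Z)"
      using gm Z unfolding mspace_submetric by (auto simp: Pi_iff image_subset_iff)
    show "mdist (submetric X ?Z) ((e \<circ> g) x) ((e \<circ> g) x') \<le> b * mdist X x x'"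
      if "x \<in> mspace X" "x' \<in> mspace X" for x x'
    proof -
      have "g x \<in> mspace Y" "g x' \<in> mspace Y" using gm that by blast+
      then show ?thesis using iso b that by simp
    qed
  qed
  moreover have "\<forall>z\<in>?Z. (e \<circ> g) z = z" using g(2) f(2) by simp
  ultimately have "Lipschitz_retraction X ?Z (e \<circ> g)" using Z by (simp add: Lipschitz_retraction_def)
  then show "\<exists>r. Lipschitz_retraction X ?Z r" by blast
qed

theorem theorem1p5:
  fixes Y :: "'y metric" and n :: nat
  assumes "mspace Y \<noteq> {}"
    and "mcomplete_of Y"
    and "nagata_dim Y \<le> ereal (real n)"
    and "\<forall>m\<le>n. Lipschitz_connected m Y"
  shows "absolute_Lipschitz_retract TYPE('x) Y \<and>
         (\<forall>X :: 'x metric. Lipschitz_extension_property X Y)"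
proof -
  obtain \<phi> K where "0 \<le> K" "\<forall>h. katetov Y h \<longrightarrow> \<phi> h \<in> mspace Y"
    "\<forall>h y. katetov Y h \<longrightarrow> y \<in> mspace Y \<longrightarrow> h y = 0 \<longrightarrow> \<phi> h = y"
    "\<forall>h h' \<delta>. katetov Y h \<longrightarrow> katetov Y h' \<longrightarrow> (\<forall>y\<in>mspace Y. \<bar>h y - h' y\<bar> \<le> \<delta>) \<longrightarrow>
       mdist Y (\<phi> h) (\<phi> h') \<le> K * \<delta>"
    using Lipschitz_map_from_katetov[OF assms] by blast
  then have "\<forall>X :: 'x metric. Lipschitz_extension_property X Y"
    using Lipschitz_extension_from_katetov[OF assms(1), of K \<phi>] by blast
  then show ?thesis using Lipschitz_retract_if_extension_property by blast
qed

end
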